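(* (i) Let $S_n$ be the star graph on $n$ vertices ($n$ even), and run asynchronous discordant voting starting from any initial colouring with exactly $n/2$ red and $n/2$ blue vertices; let $T$ be the time to consensus. Then $\mathbf{E}\,T(\text{Push})=\Theta(n^2\log n)$ and $\mathbf{E}\,T(\text{Pull})=O(n^2)$. (ii) Let $S^*_n$ be the double star on $n$ vertices, consisting of two stars $S_1,S_2$ with the same number of leaves and centres $c_1,c_2$, together with the edge $c_1c_2$. Start from the colouring in which all vertices of $S_1$ (centre and leaves) are red and all vertices of $S_2$ are blue, and let $T$ be the time to consensus. Then $\mathbf{E}\,T(\text{Push})=\Omega(2^{n/5})$ and $\mathbf{E}\,T(\text{Pull})=O(n^4)$.
   Context: Discordant voting on a graph $G=(V,E)$: each vertex holds colour red or blue. An edge is discordant if its endpoints have different colours; a vertex is discordant if it is incident to a discordant edge; $D(X)$ is the set of discordant vertices of configuration $X$. Push rule: choose $v\in D(X_t)$ uniformly at random and a discordant neighbour $u$ of $v$ uniformly at random; $u$ adopts the colour of $v$. Pull rule: same choice, but $v$ adopts the colour of $u$. All other vertices keep their colours. $T$ is the first time at which all vertices have the same colour. The star graph $S_n$ has one central vertex adjacent to $n-1$ leaves. *)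

theory Defs
  imports "HOL-Probability.Probability"
begin

section \<open>Discordant voting on a graph with vertex set \<open>V\<close> and edge set \<open>E\<close>\<close>

text \<open>
  An edge is the two-element set of its endpoints.
  Colours outside \<open>V\<close> never matter and never change.
\<close>

datatype colour = Red | Blue

datatype voting_rule = Push | Pull

type_synonym 'v colouring = "'v \<Rightarrow> colour"

definition discordant_edges :: "'v set set \<Rightarrow> 'v colouring \<Rightarrow> 'v set set" where
  "discordant_edges E X = {{u, v} | u v. {u, v} \<in> E \<and> X u \<noteq> X v}"

definition discordant_vertices :: "'v set \<Rightarrow> 'v set set \<Rightarrow> 'v colouring \<Rightarrow> 'v set" where
  "discordant_vertices V E X = {v \<in> V. \<exists>e\<in>discordant_edges E X. v \<in> e}"

definition discordant_neighbours :: "'v set set \<Rightarrow> 'v colouring \<Rightarrow> 'v \<Rightarrow> 'v set" where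
  "discordant_neighbours E X v = {u. {u, v} \<in> discordant_edges E X}"

definition consensus :: "'v set \<Rightarrow> 'v colouring \<Rightarrow> bool" where
  "consensus V X \<longleftrightarrow> (\<forall>u\<in>V. \<forall>v\<in>V. X u = X v)"

text \<open>
  Without discordant vertices there is nothing to choose and the colouring stays put.  In a
  connected graph this happens only after consensus, so it does not affect the consensus time.
\<close>

definition voting_step ::
    "voting_rule \<Rightarrow> 'v set \<Rightarrow> 'v set set \<Rightarrow> 'v colouring \<Rightarrow> 'v colouring pmf" where
  "voting_step r V E X =
    (if discordant_vertices V E X = {} then return_pmf X
     else do {
       v \<leftarrow> pmf_of_set (discordant_vertices V E X);
       u \<leftarrow> pmf_of_set (discordant_neighbours E X v);
       return_pmf (case r of Push \<Rightarrow> X(u := X v) | Pull \<Rightarrow> X(v := X u))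
     })"

text \<open>
  The law of the whole trajectory \<open>X\<^sub>0, X\<^sub>1, \<dots>\<close> is built by the Ionescu-Tulcea theorem:
  \<open>voting_kernel r V E X0 t \<omega>\<close> is the conditional law of \<open>X\<^sub>t\<close> given the earlier
  colourings \<open>\<omega> 0, \<dots>, \<omega> (t - 1)\<close>.
\<close>

definition voting_kernel ::
    "voting_rule \<Rightarrow> 'v set \<Rightarrow> 'v set set \<Rightarrow> 'v colouring \<Rightarrow> nat \<Rightarrow> (nat \<Rightarrow> 'v colouring)
      \<Rightarrow> 'v colouring measure" where
  "voting_kernel r V E X0 t \<omega> =
    measure_pmf (case t of 0 \<Rightarrow> return_pmf X0 | Suc s \<Rightarrow> voting_step r V E (\<omega> s))"

interpretation voting: Ionescu_Tulcea "voting_kernel r V E X0" "\<lambda>_. count_space UNIV"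
  for r :: voting_rule and V :: "'v set" and E :: "'v set set" and X0 :: "'v colouring"
proof (rule Ionescu_Tulcea.intro)
  fix t
  show "voting_kernel r V E X0 t
      \<in> PiM {0..<t} (\<lambda>_. count_space UNIV) \<rightarrow>\<^sub>M subprob_algebra (count_space UNIV)"
  proof (cases t)
    case 0
    then show ?thesis
      by (simp add: voting_kernel_def[abs_def] space_subprob_algebra prob_space_measure_pmf
          prob_space_imp_subprob_space)
  next
    case (Suc s)
    have "(\<lambda>\<omega>. \<omega> s) \<in> PiM {0..<t} (\<lambda>_. count_space (UNIV :: 'v colouring set)) \<rightarrow>\<^sub>M count_space UNIV"
      using Suc by (intro measurable_component_singleton) auto
    moreover have "(\<lambda>X. measure_pmf (voting_step r V E X))
        \<in> count_space UNIV \<rightarrow>\<^sub>M subprob_algebra (count_space UNIV)"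
      by (simp add: space_subprob_algebra prob_space_measure_pmf prob_space_imp_subprob_space)
    ultimately have "(\<lambda>\<omega>. measure_pmf (voting_step r V E (\<omega> s)))
        \<in> PiM {0..<t} (\<lambda>_. count_space UNIV) \<rightarrow>\<^sub>M subprob_algebra (count_space UNIV)"
      by (rule measurable_compose)
    then show ?thesis
      by (simp only: voting_kernel_def[abs_def] Suc nat.case)
  qed
qed (simp add: voting_kernel_def prob_space_measure_pmf)

definition voting_process ::
    "voting_rule \<Rightarrow> 'v set \<Rightarrow> 'v set set \<Rightarrow> 'v colouring \<Rightarrow> (nat \<Rightarrow> 'v colouring) measure" where
  "voting_process r V E X0 = voting.PF.lim r V E X0"

definition consensus_time :: "'v set \<Rightarrow> (nat \<Rightarrow> 'v colouring) \<Rightarrow> enat" where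
  "consensus_time V \<omega> = (INF t\<in>{t. consensus V (\<omega> t)}. enat t)"

definition expected_consensus_time ::
    "voting_rule \<Rightarrow> 'v set \<Rightarrow> 'v set set \<Rightarrow> 'v colouring \<Rightarrow> ennreal" where
  "expected_consensus_time r V E X0 =
    (\<integral>\<^sup>+ \<omega>. ennreal_of_enat (consensus_time V \<omega>) \<partial>voting_process r V E X0)"

text \<open>
  The next facts confirm that \<open>voting_process\<close> is the intended Markov chain and that the
  consensus time is a random variable on it.
\<close>

lemma sets_voting_process [measurable_cong]:
  "sets (voting_process r V E X0) = sets (PiM UNIV (\<lambda>_. count_space UNIV))"
  by (simp add: voting_process_def voting.PF.sets_lim)

lemma prob_space_voting_process: "prob_space (voting_process r V E X0)"
proof -
  have "emeasure (voting.PF.lim r V E X0)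
      (prod_emb UNIV (\<lambda>_. count_space UNIV) {} (space (PiM {} (\<lambda>_. count_space UNIV)))) =
     emeasure (voting.CI r V E X0 {}) (space (PiM {} (\<lambda>_. count_space UNIV)))"
    by (rule voting.lim) auto
  moreover have "prob_space (voting.CI r V E X0 {})"
    by (rule voting.PF.prob_space_P) auto
  moreover have "space (voting.CI r V E X0 {}) = space (PiM {} (\<lambda>_. count_space UNIV))"
    by (simp add: voting.CI_def)
  ultimately show ?thesis
    unfolding voting_process_def
    by (intro prob_spaceI)
      (auto dest!: prob_space.emeasure_space_1
        simp: voting.PF.space_lim prod_emb_def space_PiM restrict_def vimage_def)
qed

lemma emeasure_voting_C:
  "emeasure (voting.C r V E X0 0 (Suc t) (\<lambda>_. undefined)) (PiE {0..<Suc t} (\<lambda>i. {x i})) =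
    (if x 0 = X0 then ennreal (\<Prod>i<t. pmf (voting_step r V E (x i)) (x (Suc i))) else 0)"
proof -
  let ?M = "\<lambda>n. PiM {0..<n} (\<lambda>_::nat. count_space (UNIV :: 'a colouring set))"
  let ?C = "\<lambda>n. voting.C r V E X0 0 n (\<lambda>_. undefined)"
  let ?A = "\<lambda>n. PiE {0..<n} (\<lambda>i. {x i})"
  have undef: "(\<lambda>_. undefined) \<in> space (?M 0)"
    by (simp add: space_PiM)
  have A: "?A n \<in> sets (?M n)" for n
    by (intro sets_PiM_I_finite) auto
  have step: "emeasure (?C (Suc n)) (?A (Suc n)) =
      emeasure (?C n) (?A n) * emeasure (voting_kernel r V E X0 n x) {x n}" for n
  proof -
    have upd: "(fun_upd \<omega> n -` ?A (Suc n)) = (if \<omega> \<in> ?A n then {x n} else {})"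
      if "\<omega> \<in> space (?M n)" for \<omega>
      using that
      by (auto simp: space_PiM PiE_iff extensional_def less_Suc_eq split: if_splits)
    have kernel: "voting_kernel r V E X0 n \<omega> = voting_kernel r V E X0 n x" if "\<omega> \<in> ?A n" for \<omega>
      using that by (cases n) (auto simp: voting_kernel_def PiE_iff)
    have "emeasure (?C (Suc n)) (?A (Suc n)) =
        (\<integral>\<^sup>+ \<omega>. emeasure (voting.eP r V E X0 n \<omega>) (?A (Suc n)) \<partial>?C n)"
      unfolding voting.C.simps add_0
      using voting.prob_space_C[OF undef, of r V E X0 n] undef
      by (intro emeasure_bind[OF _ _ A])
        (auto simp: prob_space.not_empty measurable_cong_sets[OF voting.sets_C[OF undef] refl])
    also have "\<dots> = (\<integral>\<^sup>+ \<omega>. emeasure (voting_kernel r V E X0 n x) {x n} * indicator (?A n) \<omega> \<partial>?C n)"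
    proof (intro nn_integral_cong)
      fix \<omega> assume "\<omega> \<in> space (?C n)"
      then have \<omega>: "\<omega> \<in> space (?M n)"
        using voting.space_C[OF undef, of r V E X0 n] by simp
      show "emeasure (voting.eP r V E X0 n \<omega>) (?A (Suc n)) =
          emeasure (voting_kernel r V E X0 n x) {x n} * indicator (?A n) \<omega>"
        using kernel[of \<omega>] by (simp add: voting.emeasure_eP[OF \<omega> A] upd[OF \<omega>])
    qed
    also have "\<dots> = emeasure (?C n) (?A n) * emeasure (voting_kernel r V E X0 n x) {x n}"
      using A[of n] voting.sets_C[OF undef, of r V E X0 n]
      by (subst nn_integral_cmult_indicator) (auto simp: mult.commute)
    finally show ?thesis .
  qed
  show ?thesis
  proof (induction t)
    case 0
    have "emeasure (?C 0) (?A 0) = 1"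
      using undef A[of 0] by simp
    then show ?case
      unfolding step by (cases "x 0 = X0") (simp_all add: voting_kernel_def emeasure_pmf_single)
  next
    case (Suc t)
    have "emeasure (voting_kernel r V E X0 (Suc t) x) {x (Suc t)} =
        ennreal (pmf (voting_step r V E (x t)) (x (Suc t)))"
      by (simp add: voting_kernel_def emeasure_pmf_single)
    then show ?case
      unfolding step[of "Suc t"] Suc.IH
      by (simp add: ennreal_mult prod_nonneg)
  qed
qed

lemma emeasure_voting_process_path:
  "emeasure (voting_process r V E X0) {\<omega>. \<forall>i\<le>t. \<omega> i = x i} =
    (if x 0 = X0 then ennreal (\<Prod>i<t. pmf (voting_step r V E (x i)) (x (Suc i))) else 0)"
proof -
  let ?A = "PiE {0..<Suc t} (\<lambda>i. {x i})"
  have A: "?A \<in> sets (PiM {0..<Suc t} (\<lambda>_. count_space UNIV))"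
    by (intro sets_PiM_I_finite) auto
  have "{\<omega>. \<forall>i\<le>t. \<omega> i = x i} = prod_emb UNIV (\<lambda>_. count_space UNIV) {0..<Suc t} ?A"
    by (auto simp: prod_emb_def space_PiM PiE_iff less_Suc_eq_le)
  moreover have "emeasure (voting.CI r V E X0 {0..<Suc t}) ?A =
      emeasure (voting.C r V E X0 0 (Suc t) (\<lambda>_. undefined)) ?A"
    unfolding voting.emeasure_CI[OF order_refl A]
    by (subst prod_emb_id) (simp_all add: space_PiM PiE_mono)
  ultimately show ?thesis
    unfolding voting_process_def emeasure_voting_C[symmetric]
    using voting.lim[OF finite_atLeastLessThan A] by (simp only:)
qed

lemma measurable_consensus_time [measurable]:
  "consensus_time V \<in> voting_process r V E X0 \<rightarrow>\<^sub>M count_space UNIV"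
proof -
  have [measurable]: "Measurable.pred (voting_process r V E X0) (\<lambda>\<omega>. consensus V (\<omega> t))" for t
    by (rule measurable_compose[where g="consensus V" and N="count_space UNIV"])
       (auto intro: measurable_component_singleton simp: measurable_cong_sets[OF sets_voting_process refl])
  have le: "consensus_time V \<omega> \<le> enat m \<longleftrightarrow> (\<exists>t\<le>m. consensus V (\<omega> t))" for \<omega> m
  proof
    assume *: "consensus_time V \<omega> \<le> enat m"
    show "\<exists>t\<le>m. consensus V (\<omega> t)"
    proof (rule ccontr)
      assume "\<not> ?thesis"
      then have "enat (Suc m) \<le> consensus_time V \<omega>"
        unfolding consensus_time_def by (intro INF_greatest) (auto simp: not_less_eq_eq)
      from order_trans[OF this *] show False by simp
    qed
  next
    assume "\<exists>t\<le>m. consensus V (\<omega> t)"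
    then show "consensus_time V \<omega> \<le> enat m"
      unfolding consensus_time_def by (auto intro: INF_lower2)
  qed
  have pred_le: "Measurable.pred (voting_process r V E X0) (\<lambda>\<omega>. consensus_time V \<omega> \<le> enat m)" for m
    unfolding le by measurable
  have eq: "consensus_time V \<omega> = enat m \<longleftrightarrow>
      consensus_time V \<omega> \<le> enat m \<and> (\<forall>k<m. \<not> consensus_time V \<omega> \<le> enat k)" for \<omega> m
    by (cases "consensus_time V \<omega>") (simp_all, meson le_neq_implies_less order_refl not_le)
  have eq_inf: "consensus_time V \<omega> = \<infinity> \<longleftrightarrow> (\<forall>m. \<not> consensus_time V \<omega> \<le> enat m)" for \<omega>
    by (cases "consensus_time V \<omega>") auto
  note [measurable] = pred_le
  have "Measurable.pred (voting_process r V E X0) (\<lambda>\<omega>. consensus_time V \<omega> = y)" for y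
  proof (cases y)
    case (enat m)
    show ?thesis
      unfolding enat eq by measurable
  next
    case infinity
    show ?thesis
      unfolding infinity eq_inf by measurable
  qed
  then have "consensus_time V -` {y} \<inter> space (voting_process r V E X0)
      \<in> sets (voting_process r V E X0)" for y
    by (simp add: pred_def vimage_def Int_def conj_commute)
  then show ?thesis
    by (simp add: measurable_count_space_eq2_countable)
qed

section \<open>The star and the double star on the vertices \<open>0, \<dots>, n - 1\<close>\<close>

text \<open>The centre of the star is \<open>0\<close>.\<close>

definition star_edges :: "nat \<Rightarrow> nat set set" where
  "star_edges n = {{0, i} | i. 0 < i \<and> i < n}"

text \<open>
  For even \<open>n = 2 * m\<close>, the two stars of the double star have the vertices \<open>0, \<dots>, m - 1\<close> with
  centre \<open>0\<close> and \<open>m, \<dots>, 2 * m - 1\<close> with centre \<open>m\<close>.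
\<close>

definition double_star_edges :: "nat \<Rightarrow> nat set set" where
  "double_star_edges n =
    (let m = n div 2
     in star_edges m \<union> (\<lambda>e. (\<lambda>i. m + i) ` e) ` star_edges m \<union> {{0, m}})"

definition double_star_colouring :: "nat \<Rightarrow> nat colouring" where
  "double_star_colouring n v = (if v < n div 2 then Red else Blue)"

end

theory Submission
  imports Defs "HOL-Real_Asymp.Real_Asymp"
begin

text \<open>
  All four bounds come from drift conditions.  A nonnegative function whose expected one-step change
  is at most \<open>-1\<close> off consensus bounds the expected consensus time from above, and a bounded function
  vanishing at consensus whose expected change is at least \<open>-1\<close> bounds it from below.

  On the star the only relevant quantity is the number \<open>k\<close> of leaves disagreeing with the centre; with
  \<open>L\<close> leaves, one step leads to \<open>k - 1\<close> or, when the centre flips, to \<open>L - k\<close>.  Under pull, the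
  centre survives long enough for all leaves to follow it with probability at least \<open>1 / (L + 1)\<close>,
  whatever the state, which gives \<open>O(n\<^sup>2)\<close>.  Under push the expected time solves a linear recursion
  explicitly; its increments behave like \<open>n\<^sup>2 / s\<close> at distance \<open>s\<close> between \<open>\<surd>n\<close> and \<open>n\<close> from the
  balanced state, whence the logarithm.

  On the double star, under pull, all leaves follow two agreeing centres before the next flip of a
  centre with probability of order \<open>1 / n\<^sup>2\<close>.  Under push, a star with \<open>x\<close> of its \<open>L\<close> leaves in the wrong
  colour drifts back to \<open>x = 0\<close>: the ratio of losing to gaining wrong leaves is about \<open>(L - x) / x\<close>,
  hence at least 4 as long as \<open>x \<le> L / 5\<close>, and reaching \<open>L / 5\<close> takes time of order
  \<open>4 ^ (L / 5)\<close>, that is \<open>2 ^ (n / 5)\<close>.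
\<close>

section \<open>Drift bounds for the consensus time\<close>

text \<open>The probability that none of the times \<open>0, ..., t\<close> sees consensus, for the
  chain started at \<open>X\<close>. Splitting off the first step lets the drift arguments run by
  induction over all starting colourings.\<close>

primrec survival :: "voting_rule \<Rightarrow> 'v set \<Rightarrow> 'v set set \<Rightarrow> nat \<Rightarrow> 'v colouring \<Rightarrow> ennreal" where
  "survival r V E 0 X = (if consensus V X then 0 else 1)"
| "survival r V E (Suc t) X =
    (if consensus V X then 0 else \<integral>\<^sup>+Y. survival r V E t Y \<partial>measure_pmf (voting_step r V E X))"

lemma nn_integral_voting_C_Suc:
  assumes [measurable]: "h \<in> borel_measurable (PiM {0..<Suc n} (\<lambda>_. count_space UNIV))"
  shows "(\<integral>\<^sup>+\<omega>. h \<omega> \<partial>voting.C r V E X0 0 (Suc n) (\<lambda>_. undefined)) =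
    (\<integral>\<^sup>+\<omega>. \<integral>\<^sup>+x. h (fun_upd \<omega> n x) \<partial>voting_kernel r V E X0 n \<omega> \<partial>voting.C r V E X0 0 n (\<lambda>_. undefined))"
proof -
  have undef: "(\<lambda>_. undefined) \<in> space (PiM {0..<0::nat} (\<lambda>_. count_space UNIV))"
    by (simp add: space_PiM)
  have "(\<integral>\<^sup>+\<omega>. h \<omega> \<partial>voting.C r V E X0 0 (Suc n) (\<lambda>_. undefined)) =
    (\<integral>\<^sup>+\<omega>. \<integral>\<^sup>+\<omega>'. h \<omega>' \<partial>voting.eP r V E X0 n \<omega> \<partial>voting.C r V E X0 0 n (\<lambda>_. undefined))"
    unfolding voting.C.simps add_0
    by (rule nn_integral_bind[where B = "PiM {0..<Suc n} (\<lambda>_. count_space UNIV)"])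
      (auto simp: measurable_cong_sets[OF voting.sets_C[OF undef] refl])
  also have "\<dots> = (\<integral>\<^sup>+\<omega>. \<integral>\<^sup>+x. h (fun_upd \<omega> n x) \<partial>voting_kernel r V E X0 n \<omega>
      \<partial>voting.C r V E X0 0 n (\<lambda>_. undefined))"
    using voting.space_C[OF undef, of r V E X0 n]
    by (intro nn_integral_cong voting.nn_integral_eP) auto
  finally show ?thesis .
qed

text \<open>The trajectory law grows at its end, whereas \<open>survival\<close> recurses at its
  beginning. An arbitrary function \<open>g\<close> of the last colouring reconciles the two: the
  last step is absorbed into \<open>g\<close>.\<close>

lemma nn_integral_voting_C_unsettled:
  fixes g :: "'v colouring \<Rightarrow> ennreal"
  shows "(\<integral>\<^sup>+\<omega>. indicator (PiE {0..<Suc t} (\<lambda>_. {X. \<not> consensus V X})) \<omega> * g (\<omega> t)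
      \<partial>voting.C r V E X0 0 (Suc t) (\<lambda>_. undefined)) =
    ((\<lambda>g X. if consensus V X then 0 else \<integral>\<^sup>+Y. g Y \<partial>measure_pmf (voting_step r V E X)) ^^ t)
      (\<lambda>X. if consensus V X then 0 else g X) X0"
proof (induction t arbitrary: g)
  case 0
  have [measurable]: "(\<lambda>\<omega>. g (\<omega> 0)) \<in> borel_measurable (PiM {0..<Suc 0} (\<lambda>_. count_space UNIV))"
    by (rule measurable_compose[of "\<lambda>\<omega>. \<omega> 0" _ "count_space UNIV"]) auto
  have [measurable]: "PiE {0..<Suc 0} (\<lambda>_. {X. \<not> consensus V X})
      \<in> sets (PiM {0..<Suc 0} (\<lambda>_. count_space UNIV))"
    by (intro sets_PiM_I_finite) auto
  let ?A = "PiE {0..<Suc 0} (\<lambda>_. {X. \<not> consensus V X})"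
  have undef: "(\<lambda>_. undefined) \<in> space (PiM {0..<0::nat} (\<lambda>_. count_space UNIV))"
    by (simp add: space_PiM)
  have "(\<integral>\<^sup>+\<omega>. indicator ?A \<omega> * g (\<omega> 0) \<partial>voting.C r V E X0 0 (Suc 0) (\<lambda>_. undefined)) =
    (\<integral>\<^sup>+\<omega>. \<integral>\<^sup>+x. indicator ?A (fun_upd \<omega> 0 x) * g (fun_upd \<omega> 0 x 0)
      \<partial>voting_kernel r V E X0 0 \<omega> \<partial>voting.C r V E X0 0 0 (\<lambda>_. undefined))"
    by (rule nn_integral_voting_C_Suc) measurable
  also have "\<dots> = (\<integral>\<^sup>+\<omega>. (if consensus V X0 then 0 else g X0) \<partial>voting.C r V E X0 0 0 (\<lambda>_. undefined))"
  proof (rule nn_integral_cong)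
    fix \<omega> assume "\<omega> \<in> space (voting.C r V E X0 0 0 (\<lambda>_. undefined))"
    then have "\<omega> \<in> extensional {}"
      using voting.space_C[OF undef, of r V E X0 0] by (simp add: space_PiM PiE_iff)
    then have "fun_upd \<omega> 0 X0 \<in> ?A \<longleftrightarrow> \<not> consensus V X0"
      by (auto simp: PiE_iff extensional_def)
    then show "(\<integral>\<^sup>+x. indicator ?A (fun_upd \<omega> 0 x) * g (fun_upd \<omega> 0 x 0) \<partial>voting_kernel r V E X0 0 \<omega>) =
        (if consensus V X0 then 0 else g X0)"
      by (simp add: voting_kernel_def)
  qed
  also have "\<dots> = (if consensus V X0 then 0 else g X0)"
    using prob_space.emeasure_space_1[OF voting.prob_space_C[OF undef, of r V E X0 0]]
    by (simp del: voting.C.simps)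
  finally show ?case
    by simp
next
  case (Suc t)
  let ?A = "\<lambda>t. PiE {0..<t} (\<lambda>_. {X. \<not> consensus V X})"
  have [measurable]: "(\<lambda>\<omega>. g (\<omega> (Suc t))) \<in> borel_measurable (PiM {0..<Suc (Suc t)} (\<lambda>_. count_space UNIV))"
    by (rule measurable_compose[of "\<lambda>\<omega>. \<omega> (Suc t)" _ "count_space UNIV"]) auto
  have [measurable]: "?A (Suc (Suc t)) \<in> sets (PiM {0..<Suc (Suc t)} (\<lambda>_. count_space UNIV))"
    by (intro sets_PiM_I_finite) auto
  have undef: "(\<lambda>_. undefined) \<in> space (PiM {0..<0::nat} (\<lambda>_. count_space UNIV))"
    by (simp add: space_PiM)
  let ?g = "\<lambda>X. if consensus V X then 0 else g X"
  have "(\<integral>\<^sup>+\<omega>. indicator (?A (Suc (Suc t))) \<omega> * g (\<omega> (Suc t))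
      \<partial>voting.C r V E X0 0 (Suc (Suc t)) (\<lambda>_. undefined)) =
    (\<integral>\<^sup>+\<omega>. \<integral>\<^sup>+x. indicator (?A (Suc (Suc t))) (fun_upd \<omega> (Suc t) x) * g x
      \<partial>voting_kernel r V E X0 (Suc t) \<omega> \<partial>voting.C r V E X0 0 (Suc t) (\<lambda>_. undefined))"
    by (subst nn_integral_voting_C_Suc) auto
  also have "\<dots> = (\<integral>\<^sup>+\<omega>. indicator (?A (Suc t)) \<omega> *
      (\<integral>\<^sup>+x. ?g x \<partial>measure_pmf (voting_step r V E (\<omega> t)))
      \<partial>voting.C r V E X0 0 (Suc t) (\<lambda>_. undefined))"
  proof (rule nn_integral_cong)
    fix \<omega> assume "\<omega> \<in> space (voting.C r V E X0 0 (Suc t) (\<lambda>_. undefined))"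
    then have "\<omega> \<in> extensional {0..<Suc t}"
      using voting.space_C[OF undef, of r V E X0 "Suc t"] by (simp add: space_PiM PiE_iff)
    then have *: "(indicator (?A (Suc (Suc t))) (fun_upd \<omega> (Suc t) x) :: ennreal) * g x =
        indicator (?A (Suc t)) \<omega> * ?g x" for x
      by (auto simp: indicator_def PiE_iff extensional_def less_Suc_eq split: if_splits)
    show "(\<integral>\<^sup>+x. indicator (?A (Suc (Suc t))) (fun_upd \<omega> (Suc t) x) * g x
      \<partial>voting_kernel r V E X0 (Suc t) \<omega>) = indicator (?A (Suc t)) \<omega> *
      (\<integral>\<^sup>+x. ?g x \<partial>measure_pmf (voting_step r V E (\<omega> t)))"
      unfolding * by (simp add: voting_kernel_def nn_integral_cmult)
  qed
  finally show ?case
    \<comment> \<open>The new \<open>g\<close> is the one-step operator applied to the old one;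
      \<open>funpow_Suc_right\<close> moves it into the iterate.\<close>
    unfolding Suc.IH[where g = "\<lambda>X. \<integral>\<^sup>+Y. (if consensus V Y then 0 else g Y) \<partial>measure_pmf (voting_step r V E X)"]
    by (simp only: funpow_Suc_right comp_def)
qed

text \<open>The event constrains only the coordinates up to \<open>t\<close>, so it is a cylinder
  and its measure is that under the finite-horizon law.\<close>

lemma emeasure_voting_process_unsettled:
  "emeasure (voting_process r V E X0) {\<omega>. \<forall>i\<le>t. \<not> consensus V (\<omega> i)} = survival r V E t X0"
proof -
  let ?A = "PiE {0..<Suc t} (\<lambda>_. {X. \<not> consensus V X})"
  have A: "?A \<in> sets (PiM {0..<Suc t} (\<lambda>_. count_space UNIV))"
    by (intro sets_PiM_I_finite) auto
  have undef: "(\<lambda>_. undefined) \<in> space (PiM {0..<0::nat} (\<lambda>_. count_space UNIV))"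
    by (simp add: space_PiM)
  have survival: "survival r V E t X =
    ((\<lambda>g X. if consensus V X then 0 else \<integral>\<^sup>+Y. g Y \<partial>measure_pmf (voting_step r V E X)) ^^ t)
      (\<lambda>X. if consensus V X then 0 else 1) X" for X
    by (induction t arbitrary: X) (simp_all cong: nn_integral_cong)
  have "{\<omega>. \<forall>i\<le>t. \<not> consensus V (\<omega> i)} = prod_emb UNIV (\<lambda>_. count_space UNIV) {0..<Suc t} ?A"
    by (auto simp: prod_emb_def space_PiM PiE_iff less_Suc_eq_le)
  then have "emeasure (voting_process r V E X0) {\<omega>. \<forall>i\<le>t. \<not> consensus V (\<omega> i)} =
      emeasure (voting.CI r V E X0 {0..<Suc t}) ?A"
    unfolding voting_process_def using voting.lim[OF finite_atLeastLessThan A] by (simp only:)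
  also have "\<dots> = emeasure (voting.C r V E X0 0 (Suc t) (\<lambda>_. undefined)) ?A"
    unfolding voting.emeasure_CI[OF order_refl A]
    by (subst prod_emb_id) (simp_all add: space_PiM PiE_mono)
  also have "\<dots> = (\<integral>\<^sup>+\<omega>. indicator ?A \<omega> * 1 \<partial>voting.C r V E X0 0 (Suc t) (\<lambda>_. undefined))"
    using A voting.sets_C[OF undef, of r V E X0 "Suc t"] by (simp del: voting.C.simps)
  also have "\<dots> = survival r V E t X0"
    unfolding nn_integral_voting_C_unsettled[where g = "\<lambda>_. 1"] survival ..
  finally show ?thesis .
qed

text \<open>The tail-sum formula for expectations; an infinite consensus time lies in every
  tail.\<close>

lemma expected_consensus_time_eq_suminf:
  "expected_consensus_time r V E X0 = (\<Sum>t. survival r V E t X0)"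
proof -
  have "{\<omega> \<in> space (voting_process r V E X0). enat t < consensus_time V \<omega>} =
      {\<omega>. \<forall>i\<le>t. \<not> consensus V (\<omega> i)}" for t
  proof -
    have "enat t < consensus_time V \<omega> \<longleftrightarrow> (\<forall>i\<le>t. \<not> consensus V (\<omega> i))" for \<omega>
    proof
      assume *: "enat t < consensus_time V \<omega>"
      show "\<forall>i\<le>t. \<not> consensus V (\<omega> i)"
      proof (intro allI impI notI)
        fix i assume "i \<le> t" "consensus V (\<omega> i)"
        then have "consensus_time V \<omega> \<le> enat t"
          unfolding consensus_time_def by (auto intro: INF_lower2)
        with * show False by simp
      qed
    next
      assume "\<forall>i\<le>t. \<not> consensus V (\<omega> i)"
      then have "enat (Suc t) \<le> consensus_time V \<omega>"
        unfolding consensus_time_def by (intro INF_greatest) (auto simp: not_less_eq_eq)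
      then show "enat t < consensus_time V \<omega>"
        by (meson enat_ord_simps(2) less_le_trans lessI)
    qed
    then show ?thesis
      using sets_eq_imp_space_eq[OF sets_voting_process[of r V E X0]] by (simp add: space_PiM)
  qed
  then show ?thesis
    unfolding expected_consensus_time_def
    by (simp add: nn_integral_enat_function emeasure_voting_process_unsettled)
qed

section \<open>Discordant vertices and one-step expectations\<close>

lemma discordant_neighbours_eq: "discordant_neighbours E X v = {u. {u, v} \<in> E \<and> X u \<noteq> X v}"
  unfolding discordant_neighbours_def discordant_edges_def
  by (auto simp: doubleton_eq_iff insert_commute)

lemma discordant_vertices_eq: "discordant_vertices V E X = {v \<in> V. discordant_neighbours E X v \<noteq> {}}"
  unfolding discordant_vertices_def discordant_neighbours_def discordant_edges_def
  by (auto simp: doubleton_eq_iff)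

lemma finite_discordant_neighbours:
  assumes "finite V" "\<Union>E \<subseteq> V"
  shows "finite (discordant_neighbours E X v)"
  by (rule finite_subset[OF _ assms(1)]) (use assms(2) in \<open>auto simp: discordant_neighbours_eq\<close>)

text \<open>Finite support makes every real function integrable, so real expectations can replace
  the nonnegative integrals in \<open>survival\<close>.\<close>

lemma finite_set_pmf_voting_step:
  assumes "finite V" "\<Union>E \<subseteq> V"
  shows "finite (set_pmf (voting_step r V E X))"
proof -
  have "finite (discordant_vertices V E X)"
    using assms(1) by (simp add: discordant_vertices_eq)
  moreover have "finite (discordant_neighbours E X v)" for v
    using assms by (rule finite_discordant_neighbours)
  ultimately show ?thesis
    by (auto simp: voting_step_def set_pmf_of_set discordant_vertices_eq)
qed

lemma expectation_voting_step:
  fixes f :: "'v colouring \<Rightarrow> real"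
  assumes "finite V" "\<Union>E \<subseteq> V" and D: "discordant_vertices V E X \<noteq> {}"
  shows "measure_pmf.expectation (voting_step r V E X) f =
    (\<Sum>v\<in>discordant_vertices V E X.
      (\<Sum>u\<in>discordant_neighbours E X v. f (case r of Push \<Rightarrow> X(u := X v) | Pull \<Rightarrow> X(v := X u))) /
        card (discordant_neighbours E X v)) / card (discordant_vertices V E X)"
proof -
  let ?D = "discordant_vertices V E X" and ?N = "discordant_neighbours E X"
  have fin: "finite ?D" "finite (?N v)" for v
    using assms(1) finite_discordant_neighbours[OF assms(1,2)] by (auto simp: discordant_vertices_eq)
  have ne: "?N v \<noteq> {}" if "v \<in> ?D" for v
    using that by (simp add: discordant_vertices_eq)
  have "measure_pmf.expectation (voting_step r V E X) f =
    (\<Sum>v\<in>?D. (\<Sum>u\<in>?N v. f (case r of Push \<Rightarrow> X(u := X v) | Pull \<Rightarrow> X(v := X u)) / card (?N v)) / card ?D)"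
    using D fin ne
    by (simp add: voting_step_def pmf_expectation_bind_pmf_of_set sum_divide_distrib divide_inverse
        mult.commute set_pmf_of_set cong: sum.cong)
  then show ?thesis
    by (simp add: sum_divide_distrib)
qed

lemma nn_integral_voting_step:
  assumes "finite V" "\<Union>E \<subseteq> V" "\<And>Y. 0 \<le> f Y"
  shows "(\<integral>\<^sup>+Y. ennreal (f Y) \<partial>measure_pmf (voting_step r V E X)) =
    ennreal (measure_pmf.expectation (voting_step r V E X) f)"
  by (intro nn_integral_eq_integral integrable_measure_pmf_finite finite_set_pmf_voting_step)
    (use assms in auto)

section \<open>Drift criteria\<close>

text \<open>The Foster-Lyapunov criterion. The truncated expectation stays below \<open>f\<close>:
  each further step costs 1, which the drift pays, and \<open>0 \<le> f\<close> starts the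
  induction.\<close>

lemma expected_consensus_time_le:
  fixes f :: "'v colouring \<Rightarrow> real"
  assumes "finite V" "\<Union>E \<subseteq> V"
    and nonneg: "\<And>X. 0 \<le> f X"
    and drift: "\<And>X. \<not> consensus V X \<Longrightarrow> 1 + measure_pmf.expectation (voting_step r V E X) f \<le> f X"
  shows "expected_consensus_time r V E X0 \<le> ennreal (f X0)"
proof -
  have "(\<Sum>t<n. survival r V E t X) \<le> ennreal (f X)" for n X
  proof (induction n arbitrary: X)
    case (Suc n)
    show ?case
    proof (cases "consensus V X")
      case True
      then have "survival r V E t X = 0" for t by (cases t) auto
      then show ?thesis by simp
    next
      case False
      have "(\<Sum>t<Suc n. survival r V E t X) =
          1 + (\<integral>\<^sup>+Y. (\<Sum>t<n. survival r V E t Y) \<partial>measure_pmf (voting_step r V E X))"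
        using False by (simp only: sum.lessThan_Suc_shift survival.simps if_False) (simp add: nn_integral_sum)
      also have "\<dots> \<le> 1 + (\<integral>\<^sup>+Y. ennreal (f Y) \<partial>measure_pmf (voting_step r V E X))"
        by (intro add_mono nn_integral_mono Suc.IH order_refl)
      also have "\<dots> = ennreal (1 + measure_pmf.expectation (voting_step r V E X) f)"
        using assms(1,2) nonneg by (simp add: nn_integral_voting_step ennreal_plus)
      also have "\<dots> \<le> ennreal (f X)"
        by (rule ennreal_leI[OF drift[OF False]])
      finally show ?thesis .
    qed
  qed simp
  then show ?thesis
    unfolding expected_consensus_time_eq_suminf suminf_eq_SUP by (intro SUP_least)
qed

text \<open>Stopping after \<open>n\<close> steps leaves a remainder of at most \<open>B\<close> on
  the event that consensus is still missing. If the expectation is finite, the probability of that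
  event tends to 0.\<close>

lemma expected_consensus_time_ge:
  fixes g :: "'v colouring \<Rightarrow> real"
  assumes "finite V" "\<Union>E \<subseteq> V"
    and nonneg: "\<And>X. 0 \<le> g X" and bounded: "\<And>X. g X \<le> B"
    and settled: "\<And>X. consensus V X \<Longrightarrow> g X = 0"
    and drift: "\<And>X. \<not> consensus V X \<Longrightarrow> g X \<le> 1 + measure_pmf.expectation (voting_step r V E X) g"
  shows "ennreal (g X0) \<le> expected_consensus_time r V E X0"
proof -
  have B: "0 \<le> B" using nonneg bounded order_trans by blast
  have le: "ennreal (g X) \<le> (\<Sum>t<n. survival r V E t X) + ennreal B * survival r V E n X" for n X
  proof (induction n arbitrary: X)
    case 0
    show ?case using bounded[of X] settled[of X] by (simp add: ennreal_leI)
  next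
    case (Suc n)
    show ?case
    proof (cases "consensus V X")
      case False
      have "ennreal (g X) \<le> ennreal (1 + measure_pmf.expectation (voting_step r V E X) g)"
        by (rule ennreal_leI[OF drift[OF False]])
      also have "\<dots> = 1 + (\<integral>\<^sup>+Y. ennreal (g Y) \<partial>measure_pmf (voting_step r V E X))"
        using assms(1,2) nonneg by (simp add: nn_integral_voting_step ennreal_plus)
      also have "\<dots> \<le> 1 + (\<integral>\<^sup>+Y. (\<Sum>t<n. survival r V E t Y) + ennreal B * survival r V E n Y
          \<partial>measure_pmf (voting_step r V E X))"
        by (intro add_mono nn_integral_mono Suc.IH order_refl)
      also have "\<dots> = (\<Sum>t<Suc n. survival r V E t X) + ennreal B * survival r V E (Suc n) X"
        using False
        by (simp only: sum.lessThan_Suc_shift survival.simps if_False)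
          (simp add: nn_integral_add nn_integral_sum nn_integral_cmult add.assoc)
      finally show ?thesis .
    qed (simp add: settled)
  qed
  show ?thesis
  proof (cases "(\<Sum>t. survival r V E t X0) = top")
    case True
    then show ?thesis by (simp add: expected_consensus_time_eq_suminf)
  next
    case False
    have "survival r V E t X0 \<noteq> top" for t
      using False ennreal_suminf_lessD[of "\<lambda>t. survival r V E t X0" top t] by (simp add: less_top)
    moreover define p where "p t = enn2real (survival r V E t X0)" for t
    ultimately have p: "0 \<le> p t" "survival r V E t X0 = ennreal (p t)" for t
      by (simp_all add: less_top)
    then have "summable p"
      using False by (intro summable_suminf_not_top) auto
    have "(\<lambda>n. (\<Sum>t<n. p t) + B * p n) \<longlonglongrightarrow> suminf p + B * 0"
      by (intro tendsto_intros summable_LIMSEQ summable_LIMSEQ_zero \<open>summable p\<close>)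
    moreover have "g X0 \<le> (\<Sum>t<n. p t) + B * p n" for n
      using le[of X0 n] p B by (simp add: sum_ennreal ennreal_mult[symmetric] ennreal_plus[symmetric] sum_nonneg del: ennreal_plus)
    ultimately have "g X0 \<le> suminf p"
      using LIMSEQ_le_const by fastforce
    then have "ennreal (g X0) \<le> ennreal (suminf p)" by (rule ennreal_leI)
    also have "\<dots> = (\<Sum>t. survival r V E t X0)"
      using p \<open>summable p\<close> by (simp add: suminf_ennreal2)
    finally show ?thesis by (simp add: expected_consensus_time_eq_suminf)
  qed
qed

text \<open>Scaling by the number of discordant vertices removes the denominator of the uniform
  choice. The sum can then run over all of \<open>V\<close>, because other vertices contribute empty
  sums, and each vertex is treated locally.\<close>

lemma voting_drift:
  fixes f :: "'v colouring \<Rightarrow> real"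
  assumes "finite V" "\<Union>E \<subseteq> V" and D: "discordant_vertices V E X \<noteq> {}"
  shows "real (card (discordant_vertices V E X)) * (measure_pmf.expectation (voting_step r V E X) f - f X) =
    (\<Sum>v\<in>V. (\<Sum>u\<in>discordant_neighbours E X v.
      f (case r of Push \<Rightarrow> X(u := X v) | Pull \<Rightarrow> X(v := X u)) - f X) / card (discordant_neighbours E X v))"
proof -
  let ?D = "discordant_vertices V E X" and ?N = "discordant_neighbours E X"
  let ?f = "\<lambda>v u. f (case r of Push \<Rightarrow> X(u := X v) | Pull \<Rightarrow> X(v := X u))"
  have fin: "finite ?D" "finite (?N v)" for v
    using assms(1) finite_discordant_neighbours[OF assms(1,2)] by (auto simp: discordant_vertices_eq)
  have "(\<Sum>v\<in>V. (\<Sum>u\<in>?N v. ?f v u - f X) / card (?N v)) =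
      (\<Sum>v\<in>?D. (\<Sum>u\<in>?N v. ?f v u - f X) / card (?N v))"
    by (rule sum.mono_neutral_right[OF assms(1)]) (auto simp: discordant_vertices_eq)
  also have "\<dots> = (\<Sum>v\<in>?D. (\<Sum>u\<in>?N v. ?f v u) / card (?N v) - f X)"
  proof (rule sum.cong)
    fix v assume "v \<in> ?D"
    then have "card (?N v) \<noteq> 0"
      using fin(2)[of v] by (simp add: discordant_vertices_eq)
    then show "(\<Sum>u\<in>?N v. ?f v u - f X) / card (?N v) = (\<Sum>u\<in>?N v. ?f v u) / card (?N v) - f X"
      by (simp add: sum_subtractf diff_divide_distrib)
  qed simp
  also have "\<dots> = (\<Sum>v\<in>?D. (\<Sum>u\<in>?N v. ?f v u) / card (?N v)) - card ?D * f X"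
    by (simp add: sum_subtractf)
  also have "\<dots> = card ?D * (measure_pmf.expectation (voting_step r V E X) f - f X)"
    using D fin(1) by (simp add: expectation_voting_step[OF assms] right_diff_distrib)
  finally show ?thesis ..
qed

lemma colour_neq_iff: "x \<noteq> y \<Longrightarrow> z \<noteq> x \<longleftrightarrow> z = y" for x y z :: colour
  by (metis (full_types) colour.exhaust)

section \<open>Leaves that disagree with their centre\<close>

definition disagreement :: "'v \<Rightarrow> 'v set \<Rightarrow> 'v colouring \<Rightarrow> nat" where
  "disagreement c S X = card {i \<in> S. X i \<noteq> X c}"

lemma disagreement_le: "finite S \<Longrightarrow> disagreement c S X \<le> card S"
  unfolding disagreement_def by (intro card_mono) auto

lemma disagreement_leaf:
  assumes "finite S" "c \<notin> S" "i \<in> S" "X i \<noteq> X c"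
  shows "disagreement c S (X(i := X c)) = disagreement c S X - 1"
proof -
  have "{j \<in> S. (X(i := X c)) j \<noteq> (X(i := X c)) c} = {j \<in> S. X j \<noteq> X c} - {i}"
    using assms by auto
  then show ?thesis
    using assms by (simp add: disagreement_def)
qed

text \<open>With two colours, a leaf disagrees with the flipped centre exactly if it agreed
  before.\<close>

lemma disagreement_centre:
  assumes "finite S" "c \<notin> S" "a \<noteq> X c"
  shows "disagreement c S (X(c := a)) = card S - disagreement c S X"
proof -
  have "{j \<in> S. (X(c := a)) j \<noteq> (X(c := a)) c} = S - {j \<in> S. X j \<noteq> X c}"
    using assms(2) by (auto simp: colour_neq_iff[OF assms(3)])
  also have "card \<dots> = card S - disagreement c S X"
    unfolding disagreement_def using assms(1) by (subst card_Diff_subset) auto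
  finally show ?thesis
    unfolding disagreement_def .
qed

lemma disagreement_other: "i \<noteq> c \<Longrightarrow> i \<notin> S \<Longrightarrow> disagreement c S (X(i := a)) = disagreement c S X"
  unfolding disagreement_def by (intro arg_cong[where f = card]) auto

section \<open>The star\<close>

abbreviation star_disagreement :: "nat \<Rightarrow> nat colouring \<Rightarrow> nat" where
  "star_disagreement n \<equiv> disagreement 0 {0<..<n}"

lemma star_edges_subset: "0 < n \<Longrightarrow> \<Union>(star_edges n) \<subseteq> {..<n}"
  by (auto simp: star_edges_def)

lemma star_disagreement_le: "star_disagreement n X \<le> n - 1"
  using disagreement_le[of "{0<..<n}" 0 X] by simp

lemma consensus_star_iff: "0 < n \<Longrightarrow> consensus {..<n} X \<longleftrightarrow> star_disagreement n X = 0"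
proof -
  assume "0 < n"
  then have "consensus {..<n} X \<longleftrightarrow> (\<forall>i<n. X i = X 0)"
    unfolding consensus_def by (metis lessThan_iff)
  also have "\<dots> \<longleftrightarrow> (\<forall>i. 0 < i \<and> i < n \<longrightarrow> X i = X 0)"
    by (metis gr0I)
  also have "\<dots> \<longleftrightarrow> star_disagreement n X = 0"
    by (auto simp: disagreement_def)
  finally show ?thesis .
qed

lemma discordant_neighbours_star:
  "0 < n \<Longrightarrow> discordant_neighbours (star_edges n) X v =
    (if v = 0 then {i \<in> {0<..<n}. X i \<noteq> X 0} else if v < n \<and> X v \<noteq> X 0 then {0} else {})"
  by (cases "v = 0") (auto simp: discordant_neighbours_eq star_edges_def doubleton_eq_iff intro!: gr0I)

lemma discordant_vertices_star:
  "0 < n \<Longrightarrow> discordant_vertices {..<n} (star_edges n) X =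
    (if star_disagreement n X = 0 then {} else insert 0 {i \<in> {0<..<n}. X i \<noteq> X 0})"
  by (auto simp: discordant_vertices_eq discordant_neighbours_star disagreement_def)

text \<open>The discordant vertices are the centre and its \<open>k\<close> disagreeing leaves, each
  picked with probability \<open>1 / (k + 1)\<close>. Under push a picked leaf flips the centre and
  a picked centre converts a leaf; pull exchanges the two effects.\<close>

lemma expectation_star_step:
  fixes F :: "nat \<Rightarrow> real"
  assumes "0 < n" and k: "star_disagreement n X = k" "0 < k"
  shows "measure_pmf.expectation (voting_step Push {..<n} (star_edges n) X) (\<lambda>Y. F (star_disagreement n Y)) =
      (F (k - 1) + real k * F (n - 1 - k)) / (real k + 1)"
    and "measure_pmf.expectation (voting_step Pull {..<n} (star_edges n) X) (\<lambda>Y. F (star_disagreement n Y)) =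
      (F (n - 1 - k) + real k * F (k - 1)) / (real k + 1)"
proof -
  let ?A = "{i \<in> {0<..<n}. X i \<noteq> X 0}"
  have A: "card ?A = k" "finite ?A" "0 \<notin> ?A"
    using k by (simp_all add: disagreement_def)
  have D: "discordant_vertices {..<n} (star_edges n) X = insert 0 ?A"
    using k assms(1) by (simp add: discordant_vertices_star)
  have leaf: "star_disagreement n (X(i := X 0)) = k - 1"
    and centre: "star_disagreement n (X(0 := X i)) = n - 1 - k" if "i \<in> ?A" for i
    using that k disagreement_leaf[of "{0<..<n}" 0 i X] disagreement_centre[of "{0<..<n}" 0 "X i" X] by auto
  have N: "discordant_neighbours (star_edges n) X 0 = ?A"
    "i \<in> ?A \<Longrightarrow> discordant_neighbours (star_edges n) X i = {0}" for i
    using assms(1) by (auto simp: discordant_neighbours_star)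
  have fin: "finite {..<n}" "\<Union>(star_edges n) \<subseteq> {..<n}"
    using star_edges_subset[OF assms(1)] by simp_all
  have ne: "discordant_vertices {..<n} (star_edges n) X \<noteq> {}"
    unfolding D by simp
  have push: "(\<Sum>v\<in>?A. (\<Sum>u\<in>discordant_neighbours (star_edges n) X v. F (star_disagreement n (X(u := X v)))) /
      card (discordant_neighbours (star_edges n) X v)) = (\<Sum>v\<in>?A. F (n - 1 - k))"
    using N(2) centre by (intro sum.cong refl) (simp del: mem_Collect_eq)
  have pull: "(\<Sum>v\<in>?A. (\<Sum>u\<in>discordant_neighbours (star_edges n) X v. F (star_disagreement n (X(v := X u)))) /
      card (discordant_neighbours (star_edges n) X v)) = (\<Sum>v\<in>?A. F (k - 1))"
    using N(2) leaf by (intro sum.cong refl) (simp del: mem_Collect_eq)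
  have push0: "(\<Sum>u\<in>?A. F (star_disagreement n (X(u := X 0)))) = (\<Sum>u\<in>?A. F (k - 1))"
    by (intro sum.cong refl arg_cong[where f = F] leaf)
  have pull0: "(\<Sum>u\<in>?A. F (star_disagreement n (X(0 := X u)))) = (\<Sum>u\<in>?A. F (n - 1 - k))"
    by (intro sum.cong refl arg_cong[where f = F] centre)
  show "measure_pmf.expectation (voting_step Push {..<n} (star_edges n) X) (\<lambda>Y. F (star_disagreement n Y)) =
      (F (k - 1) + real k * F (n - 1 - k)) / (real k + 1)"
    unfolding expectation_voting_step[OF fin ne] voting_rule.case
    unfolding D sum.insert[OF A(2,3)] card_insert_disjoint[OF A(2,3)] push N(1) push0
    using A k by (simp add: add.commute)
  show "measure_pmf.expectation (voting_step Pull {..<n} (star_edges n) X) (\<lambda>Y. F (star_disagreement n Y)) =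
      (F (n - 1 - k) + real k * F (k - 1)) / (real k + 1)"
    unfolding expectation_voting_step[OF fin ne] voting_rule.case
    unfolding D sum.insert[OF A(2,3)] card_insert_disjoint[OF A(2,3)] pull N(1) pull0
    using A k by (simp add: add.commute)
qed

text \<open>Whatever colour the centre has, all \<open>m\<close> vertices of the opposite colour are
  leaves.\<close>

lemma star_disagreement_balanced:
  assumes "card {v \<in> {..<2*m}. X v = Red} = m" "card {v \<in> {..<2*m}. X v = Blue} = m"
  shows "star_disagreement (2*m) X = m"
proof (cases "X 0")
  case Red
  then have "{i \<in> {0<..<2*m}. X i \<noteq> X 0} = {v \<in> {..<2*m}. X v = Blue}"
    by (auto intro: gr0I colour.exhaust)
  with assms show ?thesis by (simp add: disagreement_def)
next
  case Blue
  then have "{i \<in> {0<..<2*m}. X i \<noteq> X 0} = {v \<in> {..<2*m}. X v = Red}"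
    by (auto intro: gr0I colour.exhaust)
  with assms show ?thesis by (simp add: disagreement_def)
qed

section \<open>Pull on the star\<close>

lemma expected_consensus_time_star_Pull_le:
  assumes "0 < n"
  shows "expected_consensus_time Pull {..<n} (star_edges n) X0 \<le> ennreal (2 * real n ^ 2)"
proof -
  define L where "L = real n - 1"
  \<comment> \<open>The solution of \<open>C = C * (L / (L + 1)) + L\<close>, so that
    \<open>F L = C\<close> and any state reached by a flip of the centre has cost at most
    \<open>C\<close>.\<close>
  define C where "C = L * (L + 1)"
  \<comment> \<open>\<open>k / (k + 1)\<close> is the probability that the centre flips before all \<open>k\<close> leaves have followed it.\<close>
  define F where "F k = C * (k / (k + 1)) + k" for k :: real
  have L: "0 \<le> L" using assms by (simp add: L_def)
  have C: "0 \<le> C" using L by (simp add: C_def)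
  have F_le: "F k \<le> C" if "0 \<le> k" "k \<le> L" for k
  proof -
    have "k / (k + 1) \<le> L / (L + 1)"
      using that by (simp add: divide_simps algebra_simps)
    then have "C * (k / (k + 1)) \<le> C * (L / (L + 1))"
      using C by (rule mult_left_mono)
    also have "\<dots> = L * L" using L by (simp add: C_def)
    finally show ?thesis using that by (simp add: F_def C_def algebra_simps)
  qed
  have "expected_consensus_time Pull {..<n} (star_edges n) X0 \<le> ennreal (F (star_disagreement n X0))"
  proof (rule expected_consensus_time_le)
    show "\<Union>(star_edges n) \<subseteq> {..<n}"
      using star_edges_subset[OF assms] .
    show "0 \<le> F (star_disagreement n X)" for X
      using C by (simp add: F_def)
    fix X assume "\<not> consensus {..<n} X"
    then have k0: "0 < star_disagreement n X"
      using assms by (simp add: consensus_star_iff)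
    define k where "k = star_disagreement n X"
    have k: "1 \<le> k" "k \<le> n - 1"
      using k0 star_disagreement_le by (auto simp: k_def)
    have k1: "1 \<le> real k" using k by simp
    have "real k * F (real k - 1) = C * (real k - 1) + real k * (real k - 1)"
      using k1 by (simp add: F_def field_simps)
    moreover have "F (real (n - 1 - k)) \<le> C"
      using k assms by (intro F_le) (auto simp: L_def of_nat_diff)
    moreover have "(real k + 1) * F (real k) = C * real k + real k * (real k + 1)"
      using k1 by (simp add: F_def field_simps)
    \<comment> \<open>With \<open>C\<close> in place of the value after a flip, the terms in
      \<open>C\<close> cancel and \<open>1 \<le> k\<close> remains.\<close>
    ultimately have "F (real (n - 1 - k)) + real k * F (real (k - 1)) + (real k + 1) \<le> (real k + 1) * F (real k)"
      using k by (simp add: of_nat_diff algebra_simps)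
    then have "1 + (F (real (n - 1 - k)) + real k * F (real (k - 1))) / (real k + 1) \<le> F (real k)"
      using k1 by (simp add: field_simps)
    then show "1 + measure_pmf.expectation (voting_step Pull {..<n} (star_edges n) X)
        (\<lambda>Y. F (real (star_disagreement n Y))) \<le> F (real (star_disagreement n X))"
      using expectation_star_step(2)[OF assms k_def[symmetric], of "\<lambda>k. F (real k)"] k
      by (simp add: k_def)
  qed auto
  also have "\<dots> \<le> ennreal (2 * real n ^ 2)"
  proof (rule ennreal_leI)
    have "F (real (star_disagreement n X0)) \<le> C"
      using star_disagreement_le[of n X0] assms by (intro F_le) (auto simp: L_def of_nat_diff)
    also have "C \<le> 2 * real n ^ 2"
      using L by (simp add: C_def L_def power2_eq_square algebra_simps)
    finally show "F (real (star_disagreement n X0)) \<le> 2 * real n ^ 2" .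
  qed
  finally show ?thesis .
qed

section \<open>Push on the star: the exact expected time\<close>

text \<open>
  Write \<open>h k\<close> for the expected push time on the star with \<open>2 * m\<close> vertices when \<open>k\<close> leaves disagree
  with the centre.  The differences \<open>h k - h (2 * m - 1 - k)\<close> are odd around \<open>m - 1/2\<close> and satisfy
  a first-order linear recursion away from the middle, solved by \<open>star_gap (m + 1)\<close>.
\<close>

primrec star_gap :: "nat \<Rightarrow> nat \<Rightarrow> real" where
  "star_gap M 0 = - 1"
| "star_gap M (Suc s) = ((real M - real s) * star_gap M s + 2 * real M) / (real M + real s)"

text \<open>A flip of the centre sends \<open>k\<close> to \<open>2 * m - 1 - k\<close>. Both lie at
  the same distance from the middle, counted as \<open>k - m + 1\<close> from above and
  \<open>m - k\<close> from below; oddness gives the sign.\<close>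

definition star_difference :: "nat \<Rightarrow> nat \<Rightarrow> real" where
  "star_difference m k = (if m \<le> k then star_gap (m + 1) (k - m + 1) else - star_gap (m + 1) (m - k))"

text \<open>The summand is \<open>h i - h (i - 1)\<close>, solved from the first-step equation
  \<open>(i + 1) * h i = (i + 1) + h (i - 1) + i * h (2 * m - 1 - i)\<close>.\<close>

definition star_push_time :: "nat \<Rightarrow> nat \<Rightarrow> real" where
  "star_push_time m k = (\<Sum>i=1..k. real i + 1 - real i * star_difference m i)"

text \<open>From \<open>k = m\<close> both moves lead to \<open>m - 1\<close>, so this gap is a
  single step. The initial value \<open>- 1\<close> is its mirror image.\<close>

lemma star_gap_1 [simp]: "0 < M \<Longrightarrow> star_gap M (Suc 0) = 1"
  by simp

lemma star_gap_nonneg: "0 < M \<Longrightarrow> 0 < s \<Longrightarrow> s \<le> Suc M \<Longrightarrow> 0 \<le> star_gap M s"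
proof (induction s)
  case (Suc s)
  then show ?case
    by (cases "s = 0") (auto intro!: divide_nonneg_nonneg add_nonneg_nonneg mult_nonneg_nonneg)
qed simp

text \<open>This form shows two regimes: increments are about 2 while \<open>s\<close> and
  \<open>s * star_gap M s\<close> are small against \<open>M\<close>; later the gap is pulled
  towards the equilibrium \<open>M / s\<close>.\<close>

lemma star_gap_increment:
  assumes "0 < M"
  shows "star_gap M (Suc s) = star_gap M s + (2 * real M - 2 * real s * star_gap M s) / (real M + real s)"
proof -
  have "0 < real M + real s" using assms by simp
  then show ?thesis by (simp add: field_simps)
qed

lemma star_gap_le_linear: "0 < M \<Longrightarrow> s \<le> Suc M \<Longrightarrow> star_gap M s \<le> 2 * real s"
proof (induction s)
  case (Suc s)
  show ?case
  proof (cases "s = 0")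
    case False
    then have "0 \<le> star_gap M s"
      using Suc.prems by (intro star_gap_nonneg) auto
    then have "(2 * real M - 2 * real s * star_gap M s) / (real M + real s) \<le> 2"
      using Suc.prems by (simp add: divide_le_eq) (smt (verit) mult_nonneg_nonneg of_nat_0_le_iff)
    then show ?thesis
      using Suc star_gap_increment[of M s] by simp
  qed (use Suc.prems in simp)
qed simp

text \<open>Up to about the square root of \<open>M\<close> the linear bound is the stronger one;
  beyond it, \<open>M \<le> s ^ 2\<close> makes the recursion preserve
  \<open>4 * M / s\<close>.\<close>

lemma star_gap_le_inverse: "0 < M \<Longrightarrow> 0 < s \<Longrightarrow> s \<le> Suc M \<Longrightarrow> star_gap M s \<le> 4 * real M / real s"
proof (induction s)
  case (Suc s)
  show ?case
  proof (cases "s ^ 2 < M")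
    case True
    have "real (s\<^sup>2) + 1 \<le> real M"
      using True by linarith
    moreover have "2 * real s \<le> real s ^ 2 + 1"
      using sum_squares_bound[of "real s" 1] by simp
    ultimately have "real (Suc s) ^ 2 \<le> 2 * real M"
      by (simp add: power2_eq_square algebra_simps)
    then have "2 * real (Suc s) \<le> 4 * real M / real (Suc s)"
      by (simp add: field_simps power2_eq_square)
    then show ?thesis
      using star_gap_le_linear[of M "Suc s"] Suc.prems by linarith
  next
    case False
    then have "real M \<le> real (s ^ 2)"
      by (simp only: of_nat_le_iff not_less)
    with Suc.prems have s: "0 < s" "real M \<le> real s ^ 2"
      by (auto intro: gr0I)
    have "(real M - real s) * star_gap M s + 2 * real M \<le> (real M - real s) * (4 * real M / real s) + 2 * real M"
      using Suc s by (intro add_right_mono mult_left_mono) auto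
    also have "\<dots> \<le> (real M + real s) * (4 * real M / real (Suc s))"
    proof -
      have "(real M - real s) * (4 * real M / real s) + 2 * real M - (real M + real s) * (4 * real M / real (Suc s))
        = 2 * real M * (2 * real M - 3 * real s ^ 2 - real s) / (real s * real (Suc s))"
        using s by (simp add: field_simps power2_eq_square)
      also have "\<dots> \<le> 0"
      proof -
        have "2 * real M - 3 * real s ^ 2 - real s \<le> 0"
          using s(2) zero_le_power2[of "real s"] of_nat_0_le_iff[of s] by linarith
        then show ?thesis
          by (intro divide_nonpos_nonneg mult_nonneg_nonpos) auto
      qed
      finally show ?thesis by simp
    qed
    finally show ?thesis
      using Suc.prems by (simp add: divide_le_eq mult.commute)
  qed
qed simp

text \<open>By the linear upper bound, the restoring term \<open>2 * s * star_gap M s\<close> is at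
  most \<open>4 * s ^ 2 \<le> M\<close>, so each increment is at least \<open>M / (2 * M)\<close>.
  The value at \<open>Suc s\<close> uses the increment at \<open>s\<close>, hence
  \<open>s - 1\<close> in the hypothesis.\<close>

lemma star_gap_ge_linear: "0 < s \<Longrightarrow> 0 < M \<Longrightarrow> 4 * (s - 1) ^ 2 \<le> M \<Longrightarrow> real s / 2 \<le> star_gap M s"
proof (induction s)
  case (Suc s)
  show ?case
  proof (cases "s = 0")
    case False
    have s2: "4 * real s ^ 2 \<le> real M"
      using Suc.prems(3) by (metis diff_Suc_1 of_nat_le_iff of_nat_mult of_nat_numeral of_nat_power)
    have "real s \<le> real s ^ 2" using False by (simp add: power2_eq_square)
    then have sM: "real s \<le> real M"
      using s2 zero_le_power2[of "real s"] by linarith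
    have "(s - 1) ^ 2 \<le> s ^ 2" by (intro power_mono) auto
    then have "4 * (s - 1) ^ 2 \<le> M"
      using Suc.prems(3) unfolding diff_Suc_1 by linarith
    then have IH: "real s / 2 \<le> star_gap M s"
      using Suc.IH Suc.prems(2) False by blast
    have "star_gap M s \<le> 2 * real s"
      using sM Suc.prems by (intro star_gap_le_linear) auto
    then have "2 * real s * star_gap M s \<le> 2 * real s * (2 * real s)"
      by (intro mult_left_mono) auto
    then have "1 / 2 \<le> (2 * real M - 2 * real s * star_gap M s) / (real M + real s)"
      using s2 sM Suc.prems by (simp add: le_divide_eq power2_eq_square)
    with IH have "real s / 2 + 1 / 2 \<le> star_gap M (Suc s)"
      unfolding star_gap_increment[OF Suc.prems(2)] by (rule add_mono)
    then show ?thesis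
      by (simp add: add_divide_distrib del: star_gap.simps)
  qed (use Suc.prems in simp)
qed simp

text \<open>The recursion preserves this bound, so it has to be checked only once, at the end
  \<open>r\<close> of the linear regime.\<close>

lemma star_gap_ge_inverse:
  assumes "0 < r" "r \<le> s" "s \<le> Suc M" "0 < M" "real M / (8 * real r) \<le> star_gap M r"
  shows "real M / (8 * real s) \<le> star_gap M s"
  using assms(2,3)
proof (induction s rule: dec_induct)
  case (step s)
  have s: "0 < real s" "real s \<le> real M" "0 < real M" using step assms by auto
  have "(real M + real s) * (real M / (8 * real (Suc s))) \<le>
      (real M - real s) * (real M / (8 * real s)) + 2 * real M"
  proof -
    have "(real M - real s) * (real M / (8 * real s)) + 2 * real M - (real M + real s) * (real M / (8 * real (Suc s)))
      = real M * (real M + 14 * real s ^ 2 + 15 * real s) / (8 * real s * real (Suc s))"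
      using s by (simp add: divide_simps) (simp add: algebra_simps power2_eq_square)
    also have "\<dots> \<ge> 0" using s by (intro divide_nonneg_nonneg mult_nonneg_nonneg) auto
    finally show ?thesis by simp
  qed
  also have "\<dots> \<le> (real M - real s) * star_gap M s + 2 * real M"
    using s step by (intro add_right_mono mult_left_mono) auto
  finally show ?case
    using s by (simp add: le_divide_eq mult.commute)
qed (use assms in simp)

lemma star_push_time_Suc:
  "star_push_time m (Suc k) = star_push_time m k + (real k + 2 - (real k + 1) * star_difference m (Suc k))"
  by (simp add: star_push_time_def)

text \<open>Induction outwards from the middle: each step adds one increment on either side, and the
  recursion of \<open>star_gap\<close> expresses that they match.\<close>

lemma star_push_time_reflect_aux:
  "j < m \<Longrightarrow> star_push_time m (m + j) - star_push_time m (m - 1 - j) = star_gap (m + 1) (j + 1)"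
proof (induction j)
  case 0
  then obtain l where l: "m = Suc l" by (cases m) auto
  show ?case
    using star_push_time_Suc[of m l] by (simp add: l star_difference_def del: star_gap.simps(2))
next
  case (Suc j)
  then obtain l where l: "m = Suc (Suc (l + j))"
    using less_iff_Suc_add by auto
  let ?G = "star_gap (m + 1)"
  have "star_difference m (Suc l) = - ?G (Suc j)" "star_difference m (Suc (m + j)) = ?G (Suc (Suc j))"
    by (simp_all add: star_difference_def l del: star_gap.simps(2))
  moreover have "star_push_time m (m + j) - star_push_time m (Suc l) = ?G (Suc j)"
    using Suc by (simp add: l)
  moreover have "(real m + 1 + (real j + 1)) * ?G (Suc (Suc j)) =
      (real m + 1 - (real j + 1)) * ?G (Suc j) + 2 * (real m + 1)"
    by (subst star_gap.simps(2)) (simp add: field_simps del: star_gap.simps(2))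
  ultimately have "star_push_time m (Suc (m + j)) - star_push_time m l = ?G (Suc (Suc j))"
    unfolding star_push_time_Suc[of m "m + j"] star_push_time_Suc[of m l, THEN eq_diff_eq[THEN iffD2, OF sym]]
    using star_push_time_Suc[of m l]
    by (simp add: l algebra_simps del: star_gap.simps(2))
  then show ?case
    by (simp add: l)
qed

text \<open>This closes the circle: \<open>star_difference\<close>, put into the increments as a
  guess, is the true reflected difference.\<close>

lemma star_push_time_reflect:
  assumes "k \<le> 2 * m - 1" "0 < m"
  shows "star_push_time m k - star_push_time m (2 * m - 1 - k) = star_difference m k"
proof (cases "m \<le> k")
  case True
  then have "k - m < m" "m + (k - m) = k" "m - 1 - (k - m) = 2 * m - 1 - k"
    using assms by auto
  then show ?thesis
    using star_push_time_reflect_aux[of "k - m" m] True by (simp only: star_difference_def if_True)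
next
  case False
  then have "m - 1 - k < m" "m + (m - 1 - k) = 2 * m - 1 - k" "m - 1 - (m - 1 - k) = k" "m - 1 - k + 1 = m - k"
    by auto
  then have "star_push_time m (2 * m - 1 - k) - star_push_time m k = star_gap (m + 1) (m - k)"
    using star_push_time_reflect_aux[of "m - 1 - k" m] by (simp only:)
  then show ?thesis
    using False by (simp add: star_difference_def)
qed

text \<open>Below the middle \<open>star_difference\<close> is nonpositive, so every summand is
  nonnegative; above it the value is at least the reflected one.\<close>

lemma star_push_time_nonneg:
  assumes "k \<le> 2 * m - 1"
  shows "0 \<le> star_push_time m k"
proof -
  have le: "0 \<le> star_push_time m k" if "k < m" for k
    unfolding star_push_time_def
  proof (rule sum_nonneg)
    fix i assume "i \<in> {1..k}"
    with that have "star_difference m i \<le> 0"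
      using star_gap_nonneg[of "m + 1" "m - i"] by (simp add: star_difference_def)
    then show "0 \<le> real i + 1 - real i * star_difference m i"
      by (smt (verit) mult_nonneg_nonpos of_nat_0_le_iff)
  qed
  show ?thesis
  proof (cases "k < m \<or> m = 0")
    case False
    then have "0 \<le> star_difference m k"
      using assms star_gap_nonneg[of "m + 1" "k - m + 1"] by (simp add: star_difference_def)
    moreover have "0 \<le> star_push_time m (2 * m - 1 - k)"
      using False assms by (intro le) auto
    ultimately show ?thesis
      using star_push_time_reflect[of k m] assms False by simp
  next
    case True
    then show ?thesis
      using le assms by (auto simp: star_push_time_def)
  qed
qed

lemma star_push_time_equation:
  assumes "0 < k" "k \<le> 2 * m - 1"
  shows "star_push_time m k =
    1 + (star_push_time m (k - 1) + real k * star_push_time m (2 * m - 1 - k)) / (real k + 1)"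
proof -
  have "0 < m" using assms by auto
  have "star_push_time m k = star_push_time m (k - 1) + (real k + 1 - real k * star_difference m k)"
    using star_push_time_Suc[of m "k - 1"] assms by (simp add: of_nat_diff)
  then have "(real k + 1) * star_push_time m k =
      (real k + 1) + (star_push_time m (k - 1) + real k * star_push_time m (2 * m - 1 - k))"
    using star_push_time_reflect[OF assms(2) \<open>0 < m\<close>, symmetric] by (simp add: algebra_simps)
  then show ?thesis by (simp add: field_simps)
qed

text \<open>The drift is exactly \<open>- 1\<close>, so both drift criteria apply to the same
  function.\<close>

lemma expected_consensus_time_star_Push:
  assumes "0 < m"
  shows "expected_consensus_time Push {..<2*m} (star_edges (2*m)) X0 =
    ennreal (star_push_time m (star_disagreement (2*m) X0))"
proof -
  let ?f = "\<lambda>X. star_push_time m (star_disagreement (2*m) X)"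
  have n: "0 < 2 * m" using assms by simp
  have nonneg: "0 \<le> ?f X" for X
    by (rule star_push_time_nonneg[OF star_disagreement_le])
  have step: "1 + measure_pmf.expectation (voting_step Push {..<2*m} (star_edges (2*m)) X) ?f = ?f X"
    if "\<not> consensus {..<2*m} X" for X
  proof -
    have "0 < star_disagreement (2*m) X"
      using that consensus_star_iff[OF n] by simp
    then show ?thesis
      using expectation_star_step(1)[OF n refl, of X "star_push_time m"]
        star_push_time_equation[OF _ star_disagreement_le, of m X] by simp
  qed
  have bounded: "?f X \<le> (\<Sum>k\<le>2 * m - 1. star_push_time m k)" for X
    using star_disagreement_le[of "2 * m" X] star_push_time_nonneg
    by (intro member_le_sum[of _ _ "star_push_time m"]) auto
  show ?thesis
  proof (rule antisym)
    show "expected_consensus_time Push {..<2*m} (star_edges (2*m)) X0 \<le> ennreal (?f X0)"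
      using star_edges_subset[OF n] nonneg step by (intro expected_consensus_time_le) auto
    show "ennreal (?f X0) \<le> expected_consensus_time Push {..<2*m} (star_edges (2*m)) X0"
    proof (rule expected_consensus_time_ge[OF _ star_edges_subset[OF n] nonneg bounded])
      show "?f X = 0" if "consensus {..<2*m} X" for X
        using that consensus_star_iff[OF n] by (simp add: star_push_time_def)
    qed (use step in auto)
  qed
qed

section \<open>Push on the star: asymptotics from the balanced state\<close>

text \<open>The summand at \<open>i = m\<close> equals 1; the others are reindexed by their distance
  \<open>s\<close> from the middle, where the gap bounds apply.\<close>

lemma star_push_time_middle:
  assumes "0 < m"
  shows "star_push_time m m = 1 + (\<Sum>s=1..m-1. real (m - s) + 1 + real (m - s) * star_gap (m + 1) s)"
proof -
  have "star_push_time m m = 1 + (\<Sum>i=1..m-1. real i + 1 + real i * star_gap (m + 1) (m - i))"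
  proof -
    have "star_push_time m m = star_push_time m (m - 1) + 1"
      using star_push_time_Suc[of m "m - 1"] assms by (simp add: star_difference_def of_nat_diff)
    also have "star_push_time m (m - 1) = (\<Sum>i=1..m-1. real i + 1 + real i * star_gap (m + 1) (m - i))"
      unfolding star_push_time_def by (intro sum.cong) (auto simp: star_difference_def)
    finally show ?thesis by simp
  qed
  also have "(\<Sum>i=1..m-1. real i + 1 + real i * star_gap (m + 1) (m - i)) =
      (\<Sum>s=1..m-1. real (m - s) + 1 + real (m - s) * star_gap (m + 1) s)"
    by (rule sum.reindex_bij_witness[of _ "\<lambda>s. m - s" "\<lambda>i. m - i"]) auto
  finally show ?thesis .
qed

lemma star_push_time_middle_le:
  assumes "2 \<le> m"
  shows "star_push_time m m \<le> 4 * real m ^ 2 + 8 * real m ^ 2 * (1 + ln (real m))"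
proof -
  have m0: "0 < m" using assms by simp
  have le: "real (m - s) + 1 + real (m - s) * star_gap (m + 1) s \<le> real m + real m * (8 * real m * inverse (real s))"
    if "s \<in> {1..m-1}" for s
  proof -
    have "star_gap (m + 1) s \<le> 4 * real (m + 1) / real s"
      using that by (intro star_gap_le_inverse) auto
    also have "\<dots> \<le> 8 * real m * inverse (real s)"
      using that assms by (simp add: divide_inverse)
    finally have "real (m - s) * star_gap (m + 1) s \<le> real m * (8 * real m * inverse (real s))"
      using that star_gap_nonneg[of "m + 1" s] by (intro mult_mono) auto
    moreover have "real (m - s) + 1 \<le> real m"
      using that by (auto simp: of_nat_diff)
    ultimately show ?thesis by linarith
  qed
  have "star_push_time m m \<le> 1 + (\<Sum>s=1..m-1. real m + real m * (8 * real m * inverse (real s)))"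
    unfolding star_push_time_middle[OF m0] by (intro add_left_mono sum_mono le)
  also have "\<dots> \<le> 1 + (\<Sum>s=1..m. real m + real m * (8 * real m * inverse (real s)))"
    by (intro add_left_mono sum_mono2) auto
  also have "\<dots> = 1 + real m ^ 2 + 8 * real m ^ 2 * harm m"
    by (simp add: sum.distrib harm_def sum_distrib_left power2_eq_square mult_ac)
  also have "\<dots> \<le> 4 * real m ^ 2 + 8 * real m ^ 2 * (1 + ln (real m))"
  proof -
    have "harm m \<le> 1 + ln (real m)"
      using euler_mascheroni_sequence_decreasing[of 1 m] assms by (simp add: harm_expand)
    moreover have "1 \<le> real m ^ 2" using assms by simp
    ultimately show ?thesis by (intro add_mono mult_left_mono) auto
  qed
  finally show ?thesis .
qed

text \<open>Only distances \<open>s\<close> from about \<open>sqrt m / 2\<close> to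
  \<open>m / 2\<close> are kept. There the weight \<open>m - s\<close> is at least
  \<open>m / 2\<close> and the gap at least \<open>m / (8 * s)\<close>; the harmonic sum over this
  range is about half of \<open>ln m\<close>.\<close>

lemma star_push_time_middle_ge:
  assumes "16 \<le> m"
  shows "real m ^ 2 / 16 * (ln (real m / 2) - 1 - ln (real m + 1) / 2) \<le> star_push_time m m"
proof -
  \<comment> \<open>The largest integer with \<open>4 * r ^ 2 \<le> m + 1\<close>;
    \<open>Suc r\<close> is the last point that \<open>star_gap_ge_linear\<close> reaches.\<close>
  define r where "r = nat \<lfloor>sqrt (real (m + 1)) / 2\<rfloor>"
  define h where "h = m div 2"
  have sq: "2 \<le> sqrt (real (m + 1))"
    using assms by (intro real_le_rsqrt) simp
  have r: "real r \<le> sqrt (real (m + 1)) / 2" "sqrt (real (m + 1)) / 2 < real r + 1"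
    unfolding r_def using sq by linarith+
  have r1: "1 \<le> r"
    unfolding r_def using sq by (simp add: le_nat_iff le_floor_iff)
  have r4: "4 * real r ^ 2 \<le> real (m + 1)"
  proof -
    have "(2 * real r) ^ 2 \<le> sqrt (real (m + 1)) ^ 2"
      using r by (intro power_mono) auto
    then show ?thesis by (simp add: power_mult_distrib)
  qed
  have r4': "real (m + 1) \<le> 4 * real (Suc r) ^ 2"
  proof -
    have "sqrt (real (m + 1)) ^ 2 \<le> (2 * real (Suc r)) ^ 2"
      using r by (intro power_mono) auto
    then show ?thesis by (simp add: power2_eq_square algebra_simps)
  qed
  have base: "real (m + 1) / (8 * real (Suc r)) \<le> star_gap (m + 1) (Suc r)"
  proof -
    have "4 * (Suc r - 1) ^ 2 \<le> m + 1"
      using r4 by (metis diff_Suc_1 of_nat_le_iff of_nat_mult of_nat_numeral of_nat_power)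
    then have "real (Suc r) / 2 \<le> star_gap (m + 1) (Suc r)"
      by (intro star_gap_ge_linear) auto
    moreover have "real (m + 1) / (8 * real (Suc r)) \<le> real (Suc r) / 2"
      using r4' by (simp add: divide_le_eq power2_eq_square algebra_simps)
    ultimately show ?thesis by linarith
  qed
  have "real m ^ 2 / 16 * (harm h - harm r) \<le> (\<Sum>s=Suc r..h. real m / 2 * (real m / (8 * real s)))"
  proof (cases "r \<le> h")
    case True
    have "harm h = harm r + (\<Sum>s=Suc r..h. inverse (real s))"
      unfolding harm_def using sum.ub_add_nat[of 1 r "\<lambda>s. inverse (real s)" "h - r"] True by simp
    then have "real m ^ 2 / 16 * (harm h - harm r) = (\<Sum>s=Suc r..h. real m ^ 2 / 16 * inverse (real s))"
      by (simp add: sum_distrib_left)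
    also have "\<dots> = (\<Sum>s=Suc r..h. real m / 2 * (real m / (8 * real s)))"
      by (intro sum.cong) (auto simp: field_simps power2_eq_square)
    finally show ?thesis by simp
  next
    \<comment> \<open>The range of summation is empty and the left-hand side is not
      positive.\<close>
    case False
    then have "harm h \<le> (harm r :: real)" by (intro harm_mono) simp
    then show ?thesis using False by (simp add: mult_nonneg_nonpos)
  qed
  also have "\<dots> \<le> (\<Sum>s=Suc r..h. real (m - s) + 1 + real (m - s) * star_gap (m + 1) s)"
  proof (rule sum_mono)
    fix s assume s: "s \<in> {Suc r..h}"
    then have "real (m + 1) / (8 * real s) \<le> star_gap (m + 1) s"
      by (intro star_gap_ge_inverse[OF _ _ _ _ base]) (auto simp: h_def)
    moreover have "real m / (8 * real s) \<le> real (m + 1) / (8 * real s)"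
      by (intro divide_right_mono) auto
    ultimately have "real m / (8 * real s) \<le> star_gap (m + 1) s"
      by linarith
    moreover have "real m / 2 \<le> real (m - s)"
      using s by (auto simp: h_def of_nat_diff)
    ultimately have "real m / 2 * (real m / (8 * real s)) \<le> real (m - s) * star_gap (m + 1) s"
      by (intro mult_mono) auto
    then show "real m / 2 * (real m / (8 * real s)) \<le> real (m - s) + 1 + real (m - s) * star_gap (m + 1) s"
      by simp
  qed
  also have "\<dots> \<le> (\<Sum>s=1..m-1. real (m - s) + 1 + real (m - s) * star_gap (m + 1) s)"
    using assms by (intro sum_mono2) (auto simp: h_def intro!: add_nonneg_nonneg mult_nonneg_nonneg star_gap_nonneg)
  also have "\<dots> \<le> star_push_time m m"
    using star_push_time_middle[of m] assms by simp
  finally have "real m ^ 2 / 16 * (harm h - harm r) \<le> star_push_time m m" .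
  moreover have "ln (real m / 2) - 1 - ln (real m + 1) / 2 \<le> harm h - harm r"
  proof -
    have "real m / 2 \<le> real h + 1" unfolding h_def by linarith
    then have "ln (real m / 2) \<le> ln (real h + 1)"
      using assms by (intro ln_mono) auto
    also have "\<dots> \<le> harm h" by (rule ln_le_harm)
    finally have "ln (real m / 2) \<le> harm h" .
    moreover have "harm r \<le> 1 + ln (real r)"
      using euler_mascheroni_sequence_decreasing[of 1 r] r1 by (simp add: harm_expand)
    moreover have "ln (real r) \<le> ln (sqrt (real (m + 1)))"
      using r r1 sq by (intro ln_mono) auto
    moreover have "ln (sqrt (real (m + 1))) = ln (real m + 1) / 2"
      by (simp add: ln_sqrt add.commute)
    ultimately show ?thesis by linarith
  qed
  then have "real m ^ 2 / 16 * (ln (real m / 2) - 1 - ln (real m + 1) / 2) \<le> real m ^ 2 / 16 * (harm h - harm r)"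
    by (intro mult_left_mono) auto
  ultimately show ?thesis by linarith
qed

text \<open>The two bounds grow like \<open>1 / 128\<close> and \<open>2\<close> times
  \<open>(2 * m) ^ 2 * ln (2 * m)\<close>; the constants leave room for lower-order terms.\<close>

lemma star_push_time_bounds:
  "\<forall>\<^sub>F m in sequentially. 1 / 256 * (real (2*m) ^ 2 * ln (real (2*m))) \<le> star_push_time m m \<and>
    star_push_time m m \<le> 10 * (real (2*m) ^ 2 * ln (real (2*m)))"
proof -
  have "\<forall>\<^sub>F m in sequentially. 1 / 256 * (real (2*m) ^ 2 * ln (real (2*m))) \<le>
      real m ^ 2 / 16 * (ln (real m / 2) - 1 - ln (real m + 1) / 2)"
    by real_asymp
  moreover have "\<forall>\<^sub>F m in sequentially. 4 * real m ^ 2 + 8 * real m ^ 2 * (1 + ln (real m)) \<le>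
      10 * (real (2*m) ^ 2 * ln (real (2*m)))"
    by real_asymp
  moreover have "\<forall>\<^sub>F m::nat in sequentially. 16 \<le> m"
    by (rule eventually_ge_at_top)
  ultimately show ?thesis
  proof eventually_elim
    case (elim m)
    then show ?case
      using star_push_time_middle_le[of m] star_push_time_middle_ge[of m] by linarith
  qed
qed

section \<open>The double star\<close>

definition two_stars_pull_bound :: "nat \<Rightarrow> real" where
  "two_stars_pull_bound L = (3 * real L + 1) * (2 * real L + 1) * (real L + 1)"

text \<open>Centres and leaf sets are abstract so that exchanging the two stars gives another
  instance; facts about \<open>z\<close> and \<open>S\<close> carry over to \<open>w\<close> and
  \<open>T\<close>.\<close>

locale two_stars =
  fixes z w :: 'v and S T :: "'v set"
  assumes finite: "finite S" "finite T"
    and disjoint: "S \<inter> T = {}" "z \<notin> S" "z \<notin> T" "w \<notin> S" "w \<notin> T" "z \<noteq> w"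
begin

definition V :: "'v set" where
  "V = insert z S \<union> insert w T"

definition E :: "'v set set" where
  "E = (\<lambda>i. {z, i}) ` S \<union> (\<lambda>i. {w, i}) ` T \<union> {{z, w}}"

lemma swap: "two_stars w z T S"
  using finite disjoint by unfold_locales auto

lemma swap_V: "two_stars.V w z T S = V"
  unfolding two_stars.V_def[OF swap] V_def by auto

lemma swap_E: "two_stars.E w z T S = E"
  unfolding two_stars.E_def[OF swap] E_def by (auto simp: insert_commute)

lemma finite_V: "finite V"
  using finite by (simp add: V_def)

lemma edges_subset: "\<Union>E \<subseteq> V"
  by (auto simp: V_def E_def)

lemma neighbours_centre:
  "discordant_neighbours E X z = {i \<in> S. X i \<noteq> X z} \<union> (if X z \<noteq> X w then {w} else {})"
  using disjoint by (auto simp: discordant_neighbours_eq E_def doubleton_eq_iff)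

lemma neighbours_leaf:
  "i \<in> S \<Longrightarrow> discordant_neighbours E X i = (if X i \<noteq> X z then {z} else {})"
  using disjoint by (auto simp: discordant_neighbours_eq E_def doubleton_eq_iff)

lemmas neighbours = neighbours_centre neighbours_leaf
  two_stars.neighbours_centre[OF swap, unfolded swap_E]
  two_stars.neighbours_leaf[OF swap, unfolded swap_E]

lemma sum_V: "(\<Sum>v\<in>V. g v) = g z + (\<Sum>i\<in>S. g i) + (g w + (\<Sum>i\<in>T. g i))" for g :: "'v \<Rightarrow> real"
  unfolding V_def using finite disjoint by (subst sum.union_disjoint) auto

lemma card_neighbours_centre:
  "card (discordant_neighbours E X z) = disagreement z S X + of_bool (X z \<noteq> X w)"
  using finite disjoint by (simp add: neighbours_centre disagreement_def)

lemma consensus_iff: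
  "consensus V X \<longleftrightarrow> disagreement z S X = 0 \<and> disagreement w T X = 0 \<and> X z = X w"
proof -
  have "consensus V X \<longleftrightarrow> (\<forall>i\<in>S. X i = X z) \<and> (\<forall>i\<in>T. X i = X w) \<and> X z = X w"
    unfolding consensus_def V_def by (auto; metis)
  then show ?thesis
    using finite by (auto simp: disagreement_def)
qed

text \<open>Every edge contains a centre, so if neither centre has a discordant neighbour, the
  colouring is constant.\<close>

lemma discordant_vertices_nonempty:
  assumes "\<not> consensus V X"
  shows "discordant_vertices V E X \<noteq> {}"
proof -
  have "\<exists>v\<in>V. discordant_neighbours E X v \<noteq> {}"
  proof (rule ccontr)
    assume "\<not> ?thesis"
    then have none: "discordant_neighbours E X v = {}" if "v \<in> V" for v
      using that by blast
    from none[of z] none[of w] have "disagreement z S X = 0" "disagreement w T X = 0" "X z = X w"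
      unfolding neighbours(1,3) disagreement_def V_def card_eq_0_iff by (auto split: if_splits)
    with assms show False
      by (simp add: consensus_iff)
  qed
  then show ?thesis
    by (auto simp: discordant_vertices_eq)
qed

lemma card_discordant_vertices_le:
  "card (discordant_vertices V E X) \<le> disagreement z S X + disagreement w T X
    + of_bool (discordant_neighbours E X z \<noteq> {}) + of_bool (discordant_neighbours E X w \<noteq> {})"
proof -
  let ?C = "\<lambda>c. if discordant_neighbours E X c \<noteq> {} then {c} else {}"
  have "discordant_vertices V E X \<subseteq> ({i \<in> S. X i \<noteq> X z} \<union> {i \<in> T. X i \<noteq> X w}) \<union> ?C z \<union> ?C w"
    using neighbours(2,4) by (auto simp: discordant_vertices_eq V_def split: if_splits)
  then have "card (discordant_vertices V E X) \<le> card (({i \<in> S. X i \<noteq> X z} \<union> {i \<in> T. X i \<noteq> X w}) \<union> ?C z \<union> ?C w)"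
    using finite by (intro card_mono) auto
  also have "\<dots> \<le> card {i \<in> S. X i \<noteq> X z} + card {i \<in> T. X i \<noteq> X w} + card (?C z) + card (?C w)"
    by (intro order_trans[OF card_Un_le] add_mono order_refl)
  also have "\<dots> = disagreement z S X + disagreement w T X
    + of_bool (discordant_neighbours E X z \<noteq> {}) + of_bool (discordant_neighbours E X w \<noteq> {})"
    by (simp add: disagreement_def)
  finally show ?thesis .
qed

section \<open>Pull on the double star\<close>

text \<open>Under pull a picked centre flips whichever discordant neighbour it looks at, and a
  picked leaf joins its centre. So each discordant vertex contributes a single term, without
  averaging over neighbours.\<close>

lemma pull_drift:
  fixes F :: "nat \<Rightarrow> bool \<Rightarrow> real"
  assumes "\<not> consensus V X"
  defines "N \<equiv> disagreement z S X + disagreement w T X" and "d \<equiv> X z \<noteq> X w"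
  shows "real (card (discordant_vertices V E X)) *
      (measure_pmf.expectation (voting_step Pull V E X)
        (\<lambda>Y. F (disagreement z S Y + disagreement w T Y) (Y z \<noteq> Y w)) - F N d) =
    real N * (F (N - 1) d - F N d) +
    of_bool (discordant_neighbours E X z \<noteq> {}) *
      (F (card S - disagreement z S X + disagreement w T X) (\<not> d) - F N d) +
    of_bool (discordant_neighbours E X w \<noteq> {}) *
      (F (disagreement z S X + (card T - disagreement w T X)) (\<not> d) - F N d)"
proof -
  let ?N = "discordant_neighbours E X"
  let ?f = "\<lambda>Y. F (disagreement z S Y + disagreement w T Y) (Y z \<noteq> Y w)"
  define g where "g v = (\<Sum>u\<in>?N v. ?f (X(v := X u)) - ?f X) / card (?N v)" for v
  have leaf1: "g i = (if X i \<noteq> X z then F (N - 1) d - F N d else 0)" if "i \<in> S" for i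
  proof (cases "X i = X z")
    case False
    have "disagreement z S X > 0"
      using False that finite by (auto simp: disagreement_def card_gt_0_iff)
    moreover have "i \<noteq> w" "i \<notin> T" "i \<noteq> z" using that disjoint by auto
    ultimately have "?f (X(i := X z)) = F (N - 1) d"
      using False that finite disjoint
      by (simp add: disagreement_leaf disagreement_other N_def d_def)
    then show ?thesis using that False by (simp add: g_def neighbours N_def d_def)
  qed (use that in \<open>simp add: g_def neighbours\<close>)
  have leaf2: "g i = (if X i \<noteq> X w then F (N - 1) d - F N d else 0)" if "i \<in> T" for i
  proof (cases "X i = X w")
    case False
    have "disagreement w T X > 0"
      using False that finite by (auto simp: disagreement_def card_gt_0_iff)
    moreover have "i \<noteq> w" "i \<notin> S" "i \<noteq> z" using that disjoint by auto
    ultimately have "?f (X(i := X w)) = F (N - 1) d"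
      using False that finite disjoint
      by (simp add: disagreement_leaf disagreement_other N_def d_def)
    then show ?thesis using that False by (simp add: g_def neighbours N_def d_def)
  qed (use that in \<open>simp add: g_def neighbours\<close>)
  have fin: "finite (?N v)" for v
    by (rule finite_discordant_neighbours[OF finite_V edges_subset])
  have neq: "X u \<noteq> X v" if "u \<in> ?N v" for u v
    using that by (simp add: discordant_neighbours_eq)
  have centre1: "g z = of_bool (?N z \<noteq> {}) *
      (F (card S - disagreement z S X + disagreement w T X) (\<not> d) - F N d)"
  proof -
    have "?f (X(z := X u)) = F (card S - disagreement z S X + disagreement w T X) (\<not> d)" if "u \<in> ?N z" for u
      using neq[OF that] disjoint finite colour_neq_iff[OF neq[OF that], of "X w"]
      by (auto simp: disagreement_centre disagreement_other d_def)
    then show ?thesis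
      using fin[of z] by (simp add: g_def N_def d_def)
  qed
  have centre2: "g w = of_bool (?N w \<noteq> {}) *
      (F (disagreement z S X + (card T - disagreement w T X)) (\<not> d) - F N d)"
  proof -
    have "?f (X(w := X u)) = F (disagreement z S X + (card T - disagreement w T X)) (\<not> d)" if "u \<in> ?N w" for u
      using neq[OF that] disjoint finite colour_neq_iff[OF neq[OF that], of "X z"]
      by (auto simp: disagreement_centre disagreement_other d_def)
    then show ?thesis
      using fin[of w] by (simp add: g_def N_def d_def)
  qed
  have "(\<Sum>i\<in>S. g i) = real (disagreement z S X) * (F (N - 1) d - F N d)"
    using finite by (simp add: leaf1 sum.If_cases disagreement_def Int_def)
  moreover have "(\<Sum>i\<in>T. g i) = real (disagreement w T X) * (F (N - 1) d - F N d)"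
    using finite by (simp add: leaf2 sum.If_cases disagreement_def Int_def)
  moreover have "real (card (discordant_vertices V E X)) *
      (measure_pmf.expectation (voting_step Pull V E X) ?f - ?f X) = (\<Sum>v\<in>V. g v)"
    using voting_drift[OF finite_V edges_subset discordant_vertices_nonempty[OF assms(1)], of Pull ?f]
    by (simp only: voting_rule.case g_def)
  ultimately show ?thesis
    unfolding sum_V centre1 centre2 by (simp add: N_def d_def ring_distribs)
qed

lemma expected_consensus_time_Pull_le:
  assumes card: "card S = L" "card T = L" and X0: "X0 z \<noteq> X0 w"
  shows "expected_consensus_time Pull V E X0 \<le> ennreal (two_stars_pull_bound L + 1)"
proof -
  define C where "C = two_stars_pull_bound L"
  \<comment> \<open>\<open>q n\<close> is the probability that \<open>n\<close> disagreeing leaves all follow two agreeing centres before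
    one of the centres flips; the summand \<open>n + 1\<close> of \<open>F\<close> pays for the steps, and \<open>C\<close> is chosen such that
    \<open>C * q (2 * L) = 3 * L + 1\<close>.\<close>
  define q where "q n = 2 / ((real n + 1) * (real n + 2))" for n :: nat
  define F where "F n d = (if d then C + 1 else C * (1 - q n) + real n + 1)" for n :: nat and d :: bool
  let ?f = "\<lambda>X. F (disagreement z S X + disagreement w T X) (X z \<noteq> X w)"
  have C: "0 \<le> C" by (simp add: C_def two_stars_pull_bound_def)
  have q: "0 \<le> q n" "q n \<le> 1" for n
    by (auto simp: q_def divide_le_eq algebra_simps)
  \<comment> \<open>Equivalent to \<open>q n = n / (n + 2) * q (n - 1)\<close>: among
    \<open>n\<close> leaves and two centres a leaf must be picked.\<close>
  have q_step: "real n * (q n - q (n - 1)) = - 2 * q n" if n: "0 < n" for n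
  proof -
    from n obtain k where "n = Suc k" by (cases n) auto
    then show ?thesis
      by (simp add: q_def divide_simps) (simp add: algebra_simps)
  qed
  \<comment> \<open>The value \<open>3 * L + 1\<close> of \<open>C * q (2 * L)\<close> covers the
    summand \<open>n + 1 \<le> 2 * L + 1\<close> and leaves a gain of \<open>L\<close>.\<close>
  have F_False_le: "F n False \<le> C - real L" if "n \<le> 2 * L" for n
  proof -
    have "q (2 * L) \<le> q n"
      using that unfolding q_def by (intro divide_left_mono mult_mono) auto
    then have "C * q (2 * L) \<le> C * q n"
      using C by (rule mult_left_mono)
    moreover have "C * q (2 * L) = 3 * real L + 1"
      by (simp add: C_def two_stars_pull_bound_def q_def divide_simps)
    ultimately show ?thesis
      using that by (simp add: F_def algebra_simps)
  qed
  have "expected_consensus_time Pull V E X0 \<le> ennreal (?f X0)"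
  proof (rule expected_consensus_time_le[OF finite_V edges_subset])
    show "0 \<le> ?f X" for X
      using C q by (simp add: F_def)
    fix X assume nc: "\<not> consensus V X"
    define a where "a = disagreement z S X"
    define b where "b = disagreement w T X"
    define d where "d = (X z \<noteq> X w)"
    define p where "p = (of_bool (discordant_neighbours E X z \<noteq> {}) :: real)"
    define p' where "p' = (of_bool (discordant_neighbours E X w \<noteq> {}) :: real)"
    let ?E = "measure_pmf.expectation (voting_step Pull V E X) ?f" and ?K = "card (discordant_vertices V E X)"
    have ab: "a \<le> L" "b \<le> L"
      using disagreement_le[OF finite(1), of z X] disagreement_le[OF finite(2), of w X] card
      by (auto simp: a_def b_def)
    have drift: "real ?K * (?E - F (a + b) d) = real (a + b) * (F (a + b - 1) d - F (a + b) d) +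
        p * (F (L - a + b) (\<not> d) - F (a + b) d) + p' * (F (a + (L - b)) (\<not> d) - F (a + b) d)"
      using pull_drift[OF nc, of F] by (simp add: a_def b_def d_def p_def p'_def card)
    have K: "real ?K \<le> real (a + b) + p + p'"
      using of_nat_mono[OF card_discordant_vertices_le[of X], where 'a = real]
      unfolding a_def b_def p_def p'_def of_nat_add of_nat_of_bool .
    have p: "0 \<le> p" "p \<le> 1" "0 \<le> p'" "p' \<le> 1"
      by (auto simp: p_def p'_def)
    have "real ?K * (?E - F (a + b) d) \<le> real ?K * (- 1)"
    proof (cases d)
      \<comment> \<open>Disagreeing centres: each of the two flips lowers \<open>F\<close> by at
        least \<open>L + 1\<close>, and there are at most \<open>2 * L + 2\<close> discordant
        vertices.\<close>
      case True
      then have "p = 1" "p' = 1"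
        using neighbours(1,3)[of X] by (auto simp: p_def p'_def d_def)
      moreover have "F (L - a + b) False \<le> C - real L" "F (a + (L - b)) False \<le> C - real L"
        using ab by (auto intro!: F_False_le)
      ultimately have "real ?K * (?E - F (a + b) d) \<le> - 2 * real L - 2"
        using True unfolding drift by (simp add: F_def)
      then show ?thesis
        using K ab \<open>p = 1\<close> \<open>p' = 1\<close> by simp
    next
      \<comment> \<open>Agreeing centres: the gain \<open>2 * C * q (a + b)\<close> from the leaves
        pays the \<open>C\<close>-part of at most two flips, and \<open>1 \<le> a + b\<close>
        settles the rest.\<close>
      case False
      then have "1 \<le> a + b"
        using nc consensus_iff[of X] by (auto simp: a_def b_def d_def)
      then have N: "1 \<le> real (a + b)"
        by linarith
      have "real (a + b) * (F (a + b - 1) False - F (a + b) False) =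
          C * (real (a + b) * (q (a + b) - q (a + b - 1))) - real (a + b)"
        using N by (simp add: F_def of_nat_diff algebra_simps)
      also have "real (a + b) * (q (a + b) - q (a + b - 1)) = - 2 * q (a + b)"
        using \<open>1 \<le> a + b\<close> by (intro q_step) linarith
      finally have shrink: "real (a + b) * (F (a + b - 1) False - F (a + b) False) =
          C * (- 2 * q (a + b)) - real (a + b)" .
      have d: "d = False" using False by simp
      have "real ?K * (?E - F (a + b) d) =
          - 2 * (C * q (a + b)) - real (a + b) + (p + p') * (C * q (a + b) - real (a + b))"
        unfolding drift unfolding d shrink by (simp add: F_def algebra_simps)
      also have "\<dots> \<le> - (real (a + b) + p + p')"
      proof -
        have "(p + p') * (C * q (a + b)) \<le> 2 * (C * q (a + b))"
          using p C q by (intro mult_right_mono) auto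
        moreover have "(p + p') * 1 \<le> (p + p') * real (a + b)"
          using p N by (intro mult_left_mono) auto
        ultimately show ?thesis by (simp add: algebra_simps)
      qed
      finally show ?thesis using K by simp
    qed
    moreover have "0 < real ?K"
      using discordant_vertices_nonempty[OF nc] finite_V by (simp add: card_gt_0_iff discordant_vertices_eq)
    ultimately have "?E - F (a + b) d \<le> - 1"
      by (rule mult_left_le_imp_le)
    then show "1 + ?E \<le> ?f X"
      by (simp add: a_def b_def d_def)
  qed
  then show ?thesis
    using X0 by (simp add: F_def C_def)
qed

end

section \<open>Push on the double star\<close>

text \<open>In contrast to \<open>disagreement\<close>, this number is unchanged when the centre
  flips, so it can track the wrong leaves under push.\<close>

definition leaf_count :: "colour \<Rightarrow> 'v set \<Rightarrow> 'v colouring \<Rightarrow> nat" where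
  "leaf_count c S X = card {i \<in> S. X i = c}"

lemma leaf_count_le: "finite S \<Longrightarrow> leaf_count c S X \<le> card S"
  unfolding leaf_count_def by (intro card_mono) auto

lemma disagreement_eq_leaf_count:
  assumes "finite S"
  shows "disagreement z S X = (if X z = c then card S - leaf_count c S X else leaf_count c S X)"
proof (cases "X z = c")
  case True
  then have "{i \<in> S. X i \<noteq> X z} = S - {i \<in> S. X i = c}" by auto
  also have "card \<dots> = card S - card {i \<in> S. X i = c}"
    using assms by (intro card_Diff_subset) auto
  finally show ?thesis using True by (simp add: disagreement_def leaf_count_def)
next
  case False
  then show ?thesis
    by (simp add: disagreement_def leaf_count_def colour_neq_iff)
qed

lemma leaf_count_leaf:
  assumes "finite S" "i \<in> S" "X i \<noteq> X z"
  shows "leaf_count c S (X(i := X z)) = (if X z = c then leaf_count c S X + 1 else leaf_count c S X - 1)"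
proof (cases "X z = c")
  case True
  then have "{j \<in> S. (X(i := X z)) j = c} = insert i {j \<in> S. X j = c}"
    using assms by auto
  then show ?thesis using assms True by (simp add: leaf_count_def)
next
  case False
  then have "{j \<in> S. (X(i := X z)) j = c} = {j \<in> S. X j = c} - {i}" "X i = c"
    using assms(2) colour_neq_iff[OF assms(3), of c] by auto
  then show ?thesis using assms False by (simp add: leaf_count_def)
qed

lemma leaf_count_other: "i \<notin> S \<Longrightarrow> leaf_count c S (X(i := a)) = leaf_count c S X"
  unfolding leaf_count_def by (intro arg_cong[where f = card]) auto

text \<open>
  For \<open>x\<close> wrong leaves and \<open>s\<close> telling whether the centre is wrong.  Base 4 matches the drift ratio at
  \<open>x = L / 5\<close>; the surcharge for a wrong centre balances the rate, about \<open>x\<close>, at which the centre turns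
  wrong against the gain from losing a wrong leaf.
\<close>

definition star_potential :: "nat \<Rightarrow> bool \<Rightarrow> real" where
  "star_potential x s = 4 ^ x * (1 + (if s then 3 / (4 * (real x + 3)) else 0))"

lemma star_potential_ge: "4 ^ x \<le> star_potential x s"
  by (simp add: star_potential_def)

text \<open>\<open>a\<close> leaves disagree with the centre, \<open>\<delta>\<close> tells whether
  the centres differ, and \<open>e\<close> is the rate at which the other centre pushes onto this
  one. The left-hand side is the drift scaled by the number of discordant vertices.\<close>

lemma star_potential_drift:
  fixes e \<delta> :: real and x L :: nat and s :: bool
  assumes x: "5 * x + 15 \<le> L" and e: "0 \<le> e" "e \<le> 1" and \<delta>: "\<delta> = 0 \<or> \<delta> = 1"
    and a: "a = (if s then real L - real x else real x)"
  shows "(a + e) * (star_potential x (\<not> s) - star_potential x s) +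
    a / (a + \<delta>) * (star_potential (if s then x + 1 else x - 1) s - star_potential x s) \<le> 1 / 4"
proof (cases s)
  case False
  have inc: "star_potential x True - star_potential x False = 4 ^ x * 3 / (4 * (real x + 3))"
    by (simp add: star_potential_def algebra_simps)
  show ?thesis
  proof (cases "x = 0")
    \<comment> \<open>Without wrong leaves only the other centre can do harm, causing the surcharge
      \<open>3 / (4 * 3)\<close>, which is the \<open>1 / 4\<close>. The quotient
      \<open>a / (a + \<delta>)\<close> is 0, even as \<open>0 / 0\<close>.\<close>
    case True
    then show ?thesis
      using False e a by (simp add: star_potential_def)
  next
    case x0: False
    then have "(4::real) ^ x = 4 * 4 ^ (x - 1)"
      by (cases x) auto
    then have dec: "star_potential (x - 1) False - star_potential x False = - (3 / 4 * 4 ^ x)"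
      by (simp add: star_potential_def)
    have "(real x + e) * (4 ^ x * 3 / (4 * (real x + 3))) \<le> (real x + 1) * (4 ^ x * 3 / (4 * (real x + 3)))"
      using e by (intro mult_right_mono) auto
    also have "\<dots> = (real x + 1) / (real x + 3) * (3 / 4 * 4 ^ x)"
      by (simp add: field_simps)
    \<comment> \<open>The offset 3 in the potential serves this comparison: for
      \<open>\<delta> = 1\<close> it amounts to \<open>1 \<le> x\<close>.\<close>
    also have "\<dots> \<le> real x / (real x + \<delta>) * (3 / 4 * 4 ^ x)"
    proof (rule mult_right_mono)
      have "(real x + 1) * (real x + \<delta>) \<le> real x * (real x + 3)"
        using \<delta> x0 by (auto simp: algebra_simps)
      moreover have "0 < real x + \<delta>" using \<delta> x0 by auto
      ultimately show "(real x + 1) / (real x + 3) \<le> real x / (real x + \<delta>)"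
        by (simp add: divide_simps mult.commute)
    qed simp
    finally have bound: "(real x + e) * (4 ^ x * 3 / (4 * (real x + 3))) \<le>
        real x / (real x + \<delta>) * (3 / 4 * 4 ^ x)" .
    have s: "s = False" using False by simp
    show ?thesis
      using bound unfolding a s if_False not_False_eq_True inc dec mult_minus_right by linarith
  qed
next
  case True
  define p where "p = 3 * (4::real) ^ x"
  have p: "0 < p" by (simp add: p_def)
  have xL: "5 * real x + 15 \<le> real L"
    using of_nat_mono[OF x, where 'a = real] by simp
  have a0: "0 < a" using a True xL by simp
  define k where "k = p / (4 * (real x + 3))"
  have k: "0 < k" using p by (simp add: k_def)
  have dec: "star_potential x False - star_potential x True = - k"
    by (simp add: star_potential_def p_def k_def algebra_simps)
  have inc: "star_potential (x + 1) True - star_potential x True = p * (1 + 1 / (real x + 4)) - k"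
    by (simp add: star_potential_def p_def k_def divide_simps algebra_simps)
  have growth: "p * (1 + 1 / (real x + 4)) \<le> (a + 1) * k"
  proof -
    have "1 + 1 / (real x + 4) \<le> (a + 1) / (4 * (real x + 3))"
    proof -
      have "4 * (real x + 3) * (real x + 5) \<le> (4 * real x + 16) * (real x + 4)"
        by (simp add: algebra_simps)
      \<comment> \<open>The restriction on \<open>x\<close> enters as
        \<open>4 * (x + 4) \<le> a + 1\<close>; the factor 4 matches the base of the
        potential.\<close>
      also have "\<dots> \<le> (a + 1) * (real x + 4)"
        using xL a True by (intro mult_right_mono) auto
      finally show ?thesis by (simp add: divide_simps) (simp add: algebra_simps)
    qed
    then have "p * (1 + 1 / (real x + 4)) \<le> p * ((a + 1) / (4 * (real x + 3)))"
      using p by (intro mult_left_mono) auto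
    then show ?thesis by (simp add: k_def mult.commute)
  qed
  have "a / (a + \<delta>) \<le> 1"
    using \<delta> a0 by auto
  moreover have "0 \<le> star_potential (x + 1) True - star_potential x True"
  proof -
    have "k \<le> p * 1"
      using p by (simp add: k_def divide_le_eq)
    also have "\<dots> \<le> p * (1 + 1 / (real x + 4))"
      using p by (intro mult_left_mono) auto
    finally show ?thesis unfolding inc by simp
  qed
  ultimately have "a / (a + \<delta>) * (star_potential (x + 1) True - star_potential x True) \<le>
      1 * (star_potential (x + 1) True - star_potential x True)"
    by (rule mult_right_mono)
  also have "\<dots> \<le> a * k"
    using growth unfolding inc mult_1 by (simp add: ring_distribs)
  also have "\<dots> \<le> (a + e) * k"
    using e k by (intro mult_right_mono) auto
  finally have "a / (a + \<delta>) * (star_potential (x + 1) True - star_potential x True) \<le> (a + e) * k" .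
  then have bound: "- ((a + e) * k) + a / (a + \<delta>) * (star_potential (x + 1) True - star_potential x True) \<le> 0"
    by (metis add.commute diff_conv_add_uminus diff_le_0_iff_le)
  have s: "s = True" using True by simp
  show ?thesis
    unfolding s if_True not_True_eq_False dec mult_minus_right
    by (rule order_trans[OF bound]) simp
qed

context two_stars
begin

text \<open>A picked discordant leaf of \<open>S\<close> flips \<open>z\<close>; if the centres
  differ, \<open>w\<close> does so when it chooses \<open>z\<close> among its
  \<open>b + \<delta>\<close> discordant neighbours; and \<open>z\<close> hits one of its leaves
  with probability \<open>a / (a + \<delta>)\<close>. Leaves of \<open>T\<close> push onto
  \<open>w\<close> only, which \<open>u\<close> does not see.\<close>

lemma push_drift:
  fixes u :: "nat \<Rightarrow> bool \<Rightarrow> real" and c :: colour and X :: "'v colouring"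
  assumes "\<not> consensus V X"
  defines "x \<equiv> leaf_count c S X" and "s \<equiv> X z = c" and "\<delta> \<equiv> of_bool (X z \<noteq> X w) :: real"
    and "a \<equiv> real (disagreement z S X)" and "b \<equiv> real (disagreement w T X)"
  shows "real (card (discordant_vertices V E X)) *
      (measure_pmf.expectation (voting_step Push V E X) (\<lambda>Y. u (leaf_count c S Y) (Y z = c)) - u x s) =
    (a + \<delta> / (b + \<delta>)) * (u x (\<not> s) - u x s) +
    a / (a + \<delta>) * (u (if s then x + 1 else x - 1) s - u x s)"
proof -
  let ?N = "discordant_neighbours E X"
  let ?f = "\<lambda>Y. u (leaf_count c S Y) (Y z = c)"
  define g where "g v = (\<Sum>i\<in>?N v. ?f (X(i := X v)) - ?f X) / card (?N v)" for v
  have flip: "?f (X(z := X v)) = u x (\<not> s)" if "X v \<noteq> X z" for v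
    using that disjoint colour_neq_iff[OF that, of c] by (auto simp: leaf_count_other x_def s_def)
  have leaf: "?f (X(i := X z)) = u (if s then x + 1 else x - 1) s" if "i \<in> S" "X i \<noteq> X z" for i
    using that disjoint finite by (auto simp: leaf_count_leaf x_def s_def)
  have other: "?f (X(i := d)) = u x s" if "i \<in> insert w T" for i d
  proof -
    have "i \<notin> S" "i \<noteq> z" using that disjoint by blast+
    then show ?thesis by (simp add: leaf_count_other x_def s_def)
  qed
  have S: "(\<Sum>i\<in>S. g i) = a * (u x (\<not> s) - u x s)"
  proof -
    have "g i = (if X i \<noteq> X z then u x (\<not> s) - u x s else 0)" if "i \<in> S" for i
      using that flip[of i] by (simp add: g_def neighbours x_def s_def)
    then show ?thesis
      using finite by (simp add: sum.If_cases disagreement_def Int_def a_def)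
  qed
  have T: "(\<Sum>i\<in>T. g i) = 0"
    using other by (intro sum.neutral) (auto simp: g_def neighbours x_def s_def)
  have z: "g z = a / (a + \<delta>) * (u (if s then x + 1 else x - 1) s - u x s)"
  proof -
    have "(\<Sum>i\<in>?N z. ?f (X(i := X z)) - ?f X) = (\<Sum>i\<in>{i \<in> S. X i \<noteq> X z}. u (if s then x + 1 else x - 1) s - u x s)"
      unfolding neighbours using other[of w] finite leaf disjoint
      by (intro sum.mono_neutral_cong_right) (auto simp: x_def s_def split: if_splits)
    then show ?thesis
      unfolding g_def card_neighbours_centre by (simp add: a_def \<delta>_def disagreement_def)
  qed
  have w: "g w = \<delta> / (b + \<delta>) * (u x (\<not> s) - u x s)"
  proof -
    have "(\<Sum>i\<in>?N w. ?f (X(i := X w)) - ?f X) = (\<Sum>i\<in>(if X z \<noteq> X w then {z} else {}). u x (\<not> s) - u x s)"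
      unfolding neighbours using other finite flip[of w] disjoint
      by (intro sum.mono_neutral_cong_right) (auto simp: x_def s_def split: if_splits)
    then show ?thesis
      unfolding g_def two_stars.card_neighbours_centre[OF swap, unfolded swap_E]
      by (simp add: b_def \<delta>_def eq_commute[of "X w"])
  qed
  have "real (card (discordant_vertices V E X)) *
      (measure_pmf.expectation (voting_step Push V E X) ?f - ?f X) = (\<Sum>v\<in>V. g v)"
    using voting_drift[OF finite_V edges_subset discordant_vertices_nonempty[OF assms(1)], of Push ?f]
    by (simp only: voting_rule.case g_def)
  then show ?thesis
    unfolding sum_V S T z w by (simp add: x_def s_def ring_distribs)
qed

lemma push_potential_drift:
  assumes "\<not> consensus V X" and "5 * leaf_count c S X + 15 \<le> card S"
  shows "measure_pmf.expectation (voting_step Push V E X) (\<lambda>Y. star_potential (leaf_count c S Y) (Y z = c)) \<le>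
    star_potential (leaf_count c S X) (X z = c) + 1 / 4"
proof -
  let ?E = "measure_pmf.expectation (voting_step Push V E X) (\<lambda>Y. star_potential (leaf_count c S Y) (Y z = c))"
  let ?K = "real (card (discordant_vertices V E X))"
  let ?\<delta> = "of_bool (X z \<noteq> X w) :: real"
  have "?K * (?E - star_potential (leaf_count c S X) (X z = c)) \<le> 1 / 4"
    unfolding push_drift[OF assms(1)]
    by (rule star_potential_drift[OF assms(2)])
      (use finite leaf_count_le[of S c X] in \<open>auto simp: disagreement_eq_leaf_count[of S z X c] of_nat_diff\<close>)
  also have "\<dots> \<le> ?K * (1 / 4)"
    using discordant_vertices_nonempty[OF assms(1)] finite_V
    by (simp add: Suc_le_eq card_gt_0_iff discordant_vertices_eq)
  finally have "?K * (?E - star_potential (leaf_count c S X) (X z = c)) \<le> ?K * (1 / 4)" .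
  moreover have "0 < ?K"
    using discordant_vertices_nonempty[OF assms(1)] finite_V by (simp add: card_gt_0_iff discordant_vertices_eq)
  ultimately have "?E - star_potential (leaf_count c S X) (X z = c) \<le> 1 / 4"
    by (rule mult_left_le_imp_le)
  then show ?thesis by simp
qed

text \<open>While each star has fewer than \<open>q\<close> wrong leaves, the two potentials
  together rise by at most \<open>1 / 2\<close> per expected step, hence the factor 2 in
  \<open>g\<close>. At consensus all leaves of one star are wrong, so the potentials reach
  \<open>W\<close> and \<open>g\<close> vanishes.\<close>

lemma expected_consensus_time_Push_ge:
  assumes card: "card S = L" "card T = L" and q: "5 * q + 15 \<le> L"
    and X0: "\<And>v. v \<in> insert z S \<Longrightarrow> X0 v = Red" "\<And>v. v \<in> insert w T \<Longrightarrow> X0 v = Blue"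
  shows "ennreal (2 * (4 ^ q - 2)) \<le> expected_consensus_time Push V E X0"
proof -
  define W where "W = (4::real) ^ q"
  define \<phi> where "\<phi> X = star_potential (leaf_count Blue S X) (X z = Blue)" for X
  define \<psi> where "\<psi> X = star_potential (leaf_count Red T X) (X w = Red)" for X
  define g where "g X = 2 * max 0 (W - (\<phi> X + \<psi> X))" for X
  have ge: "4 ^ leaf_count Blue S X \<le> \<phi> X" "4 ^ leaf_count Red T X \<le> \<psi> X" for X
    unfolding \<phi>_def \<psi>_def by (rule star_potential_ge)+
  have nonneg: "0 \<le> \<phi> X" "0 \<le> \<psi> X" for X
    using ge[of X] by (meson order_trans zero_le_numeral zero_le_power)+
  have int: "integrable (measure_pmf (voting_step Push V E X)) f" for X and f :: "'v colouring \<Rightarrow> real"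
    by (intro integrable_measure_pmf_finite finite_set_pmf_voting_step finite_V edges_subset)
  have "ennreal (g X0) \<le> expected_consensus_time Push V E X0"
  proof (rule expected_consensus_time_ge[OF finite_V edges_subset])
    show "0 \<le> g X" for X by (simp add: g_def)
    show "g X \<le> 2 * W" for X
      using nonneg[of X] by (simp add: g_def W_def)
    show "g X = 0" if "consensus V X" for X
    proof -
      have "leaf_count Blue S X = L \<or> leaf_count Red T X = L"
      proof (cases "X z")
        case Red
        then have "{i \<in> T. X i = Red} = T"
          using that by (force simp: consensus_def V_def)
        then show ?thesis by (simp add: leaf_count_def card)
      next
        case Blue
        then have "{i \<in> S. X i = Blue} = S"
          using that by (force simp: consensus_def V_def)
        then show ?thesis by (simp add: leaf_count_def card)
      qed
      then have "4 ^ L \<le> \<phi> X + \<psi> X"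
        using ge[of X] nonneg[of X] by auto
      moreover have "W \<le> 4 ^ L"
        unfolding W_def using q by (intro power_increasing) auto
      ultimately show ?thesis by (simp add: g_def)
    qed
    show "g X \<le> 1 + measure_pmf.expectation (voting_step Push V E X) g" if nc: "\<not> consensus V X" for X
    proof (cases "W \<le> \<phi> X + \<psi> X")
      case True
      have "0 \<le> measure_pmf.expectation (voting_step Push V E X) g"
        by (rule integral_nonneg_AE) (simp add: g_def)
      then show ?thesis using True by (simp add: g_def)
    next
      case False
      then have "(4::real) ^ leaf_count Blue S X < 4 ^ q" "(4::real) ^ leaf_count Red T X < 4 ^ q"
        using ge[of X] nonneg[of X] unfolding W_def by linarith+
      then have "leaf_count Blue S X < q" "leaf_count Red T X < q"
        by simp_all
      then have "measure_pmf.expectation (voting_step Push V E X) \<phi> \<le> \<phi> X + 1 / 4"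
        "measure_pmf.expectation (voting_step Push V E X) \<psi> \<le> \<psi> X + 1 / 4"
        using push_potential_drift[OF nc, of Blue]
          two_stars.push_potential_drift[OF swap, unfolded swap_V swap_E, OF nc, of Red] q card
        by (simp_all add: \<phi>_def[abs_def] \<psi>_def[abs_def])
      moreover have "2 * (W - (measure_pmf.expectation (voting_step Push V E X) \<phi> +
          measure_pmf.expectation (voting_step Push V E X) \<psi>)) =
        measure_pmf.expectation (voting_step Push V E X) (\<lambda>Y. 2 * (W - (\<phi> Y + \<psi> Y)))"
        using int by simp
      moreover have "\<dots> \<le> measure_pmf.expectation (voting_step Push V E X) g"
        by (intro integral_mono int) (auto simp: g_def max_def)
      ultimately show ?thesis
        using False by (simp add: g_def)
    qed
  qed
  moreover have "2 * (W - 2) \<le> g X0"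
  proof -
    have "leaf_count Blue S X0 = 0" "leaf_count Red T X0 = 0"
      using X0 by (auto simp: leaf_count_def card_eq_0_iff)
    then show ?thesis
      using X0 by (simp add: g_def \<phi>_def \<psi>_def star_potential_def max_def)
  qed
  ultimately show ?thesis
    unfolding W_def by (meson ennreal_leI order_trans)
qed

end

section \<open>The concrete double star and even \<open>n\<close>\<close>

lemma two_stars_double_star: "0 < m \<Longrightarrow> two_stars 0 m {0<..<m} {m<..<2 * m}" for m :: nat
  by unfold_locales auto

lemma double_star_V: "0 < m \<Longrightarrow> two_stars.V 0 m {0<..<m} {m<..<2 * m} = {..<2 * m}" for m :: nat
  by (subst two_stars.V_def[OF two_stars_double_star]) auto

lemma double_star_E: "0 < m \<Longrightarrow> two_stars.E 0 m {0<..<m} {m<..<2 * m} = double_star_edges (2 * m)"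
proof -
  assume m: "0 < m"
  have "star_edges m = (\<lambda>i. {0, i}) ` {0<..<m}"
    by (auto simp: star_edges_def)
  moreover have "(\<lambda>i. {m, i}) ` {m<..<2 * m} = (\<lambda>i. {m, m + i}) ` {0<..<m}"
  proof -
    have "x \<in> (\<lambda>i. m + i) ` {0<..<m}" if "x \<in> {m<..<2 * m}" for x
      using that by (intro image_eqI[of _ _ "x - m"]) auto
    then have "{m<..<2 * m} = (\<lambda>i. m + i) ` {0<..<m}"
      by auto
    then show ?thesis by (simp add: image_image)
  qed
  ultimately show ?thesis
    by (simp add: two_stars.E_def[OF two_stars_double_star[OF m]] double_star_edges_def image_image Let_def)
qed

lemma expected_consensus_time_double_star_Pull_le:
  assumes "0 < m"
  shows "expected_consensus_time Pull {..<2 * m} (double_star_edges (2 * m)) (double_star_colouring (2 * m))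
    \<le> ennreal (real (2 * m) ^ 4)"
proof -
  have "expected_consensus_time Pull {..<2 * m} (double_star_edges (2 * m)) (double_star_colouring (2 * m))
      \<le> ennreal (two_stars_pull_bound (m - 1) + 1)"
    using two_stars.expected_consensus_time_Pull_le[OF two_stars_double_star[OF assms], of "m - 1"
        "double_star_colouring (2 * m)"] assms
    by (simp add: double_star_V double_star_E double_star_colouring_def)
  also have "\<dots> \<le> ennreal (real (2 * m) ^ 4)"
  proof (rule ennreal_leI)
    obtain l where "m = Suc l" using assms by (cases m) auto
    then show "two_stars_pull_bound (m - 1) + 1 \<le> real (2 * m) ^ 4"
      by (simp add: two_stars_pull_bound_def power4_eq_xxxx algebra_simps)
  qed
  finally show ?thesis .
qed

lemma expected_consensus_time_double_star_Push_ge: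
  assumes "21 \<le> m"
  shows "ennreal (1 / 256 * 2 powr (real (2 * m) / 5))
    \<le> expected_consensus_time Push {..<2 * m} (double_star_edges (2 * m)) (double_star_colouring (2 * m))"
proof -
  \<comment> \<open>The largest \<open>q\<close> with \<open>5 * q + 15 \<le> m - 1\<close>. Then
    \<open>2 * m / 5 \<le> 2 * q + 8\<close>, so rounding costs a factor of at most
    \<open>2 ^ 8 = 256\<close>.\<close>
  define q where "q = (m - 16) div 5"
  have m: "0 < m" using assms by simp
  have q: "5 * q + 15 \<le> m - 1" "1 \<le> q" "m \<le> 5 * q + 20"
    using assms by (auto simp: q_def)
  have "1 / 256 * 2 powr (real (2 * m) / 5) \<le> 1 / 256 * 2 powr (2 * real q + 8)"
    using q(3) by (intro mult_left_mono powr_mono) auto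
  also have "\<dots> = 4 ^ q"
    by (simp add: powr_add powr_powr[symmetric] powr_realpow)
  \<comment> \<open>This is \<open>4 \<le> 4 ^ q\<close>, guaranteed by
    \<open>21 \<le> m\<close>.\<close>
  also have "\<dots> \<le> 2 * (4 ^ q - 2)"
    using power_increasing[OF q(2), of "4::real"] by simp
  finally have "ennreal (1 / 256 * 2 powr (real (2 * m) / 5)) \<le> ennreal (2 * (4 ^ q - 2))"
    by (rule ennreal_leI)
  also have "\<dots> \<le> expected_consensus_time Push {..<2 * m} (double_star_edges (2 * m)) (double_star_colouring (2 * m))"
    by (rule two_stars.expected_consensus_time_Push_ge[OF two_stars_double_star[OF m], of "m - 1" q,
          unfolded double_star_V[OF m] double_star_E[OF m]])
      (use q m in \<open>auto simp: double_star_colouring_def\<close>)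
  finally show ?thesis .
qed

lemma eventually_even_div_2:
  assumes "\<forall>\<^sub>F m in sequentially. P m"
  shows "\<forall>\<^sub>F n in sequentially. even n \<longrightarrow> (\<exists>m. n = 2 * m \<and> P m)"
proof -
  obtain N where N: "P m" if "N \<le> m" for m
    using assms by (auto simp: eventually_sequentially)
  show ?thesis
    unfolding eventually_sequentially
  proof (rule exI[of _ "2 * N"], intro allI impI)
    fix n :: nat assume "2 * N \<le> n" "even n"
    then show "\<exists>m. n = 2 * m \<and> P m"
      using N[of "n div 2"] by (intro exI[of _ "n div 2"]) auto
  qed
qed

theorem theorem3:
  shows "(\<exists>a b. 0 < a \<and> 0 < b \<and>
      (\<forall>\<^sub>F n in sequentially. even n \<longrightarrow>
        (\<forall>X0. card {v \<in> {..<n}. X0 v = Red} = n div 2 \<and> card {v \<in> {..<n}. X0 v = Blue} = n div 2 \<longrightarrow>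
          ennreal (a * (real n ^ 2 * ln (real n)))
            \<le> expected_consensus_time Push {..<n} (star_edges n) X0 \<and>
          expected_consensus_time Push {..<n} (star_edges n) X0
            \<le> ennreal (b * (real n ^ 2 * ln (real n))))))
   \<and> (\<exists>b>0. \<forall>\<^sub>F n in sequentially. even n \<longrightarrow>
        (\<forall>X0. card {v \<in> {..<n}. X0 v = Red} = n div 2 \<and> card {v \<in> {..<n}. X0 v = Blue} = n div 2 \<longrightarrow>
          expected_consensus_time Pull {..<n} (star_edges n) X0 \<le> ennreal (b * real n ^ 2)))
   \<and> (\<exists>a>0. \<forall>\<^sub>F n in sequentially. even n \<longrightarrow>
        ennreal (a * 2 powr (real n / 5))
          \<le> expected_consensus_time Push {..<n} (double_star_edges n) (double_star_colouring n))
   \<and> (\<exists>b>0. \<forall>\<^sub>F n in sequentially. even n \<longrightarrow>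
        expected_consensus_time Pull {..<n} (double_star_edges n) (double_star_colouring n)
          \<le> ennreal (b * real n ^ 4))"
proof (intro conjI)
  show "\<exists>a b. 0 < a \<and> 0 < b \<and>
      (\<forall>\<^sub>F n in sequentially. even n \<longrightarrow>
        (\<forall>X0. card {v \<in> {..<n}. X0 v = Red} = n div 2 \<and> card {v \<in> {..<n}. X0 v = Blue} = n div 2 \<longrightarrow>
          ennreal (a * (real n ^ 2 * ln (real n)))
            \<le> expected_consensus_time Push {..<n} (star_edges n) X0 \<and>
          expected_consensus_time Push {..<n} (star_edges n) X0
            \<le> ennreal (b * (real n ^ 2 * ln (real n)))))"
  proof (rule exI[of _ "1 / 256"], rule exI[of _ 10], intro conjI)
    show "\<forall>\<^sub>F n in sequentially. even n \<longrightarrow>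
        (\<forall>X0. card {v \<in> {..<n}. X0 v = Red} = n div 2 \<and> card {v \<in> {..<n}. X0 v = Blue} = n div 2 \<longrightarrow>
          ennreal (1 / 256 * (real n ^ 2 * ln (real n)))
            \<le> expected_consensus_time Push {..<n} (star_edges n) X0 \<and>
          expected_consensus_time Push {..<n} (star_edges n) X0
            \<le> ennreal (10 * (real n ^ 2 * ln (real n))))"
      using eventually_even_div_2[OF eventually_conj[OF star_push_time_bounds eventually_gt_at_top[of 0]]]
    proof eventually_elim
      case (elim n)
      show ?case
      proof (intro impI allI)
        fix X0 :: "nat colouring"
        assume "even n" and balanced: "card {v \<in> {..<n}. X0 v = Red} = n div 2 \<and>
          card {v \<in> {..<n}. X0 v = Blue} = n div 2"
        with elim obtain m where n: "n = 2 * m" and m: "0 < m"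
          and bounds: "1 / 256 * (real (2*m) ^ 2 * ln (real (2*m))) \<le> star_push_time m m"
            "star_push_time m m \<le> 10 * (real (2*m) ^ 2 * ln (real (2*m)))"
          by blast
        have "star_disagreement (2 * m) X0 = m"
          using balanced n by (intro star_disagreement_balanced) auto
        then show "ennreal (1 / 256 * (real n ^ 2 * ln (real n)))
            \<le> expected_consensus_time Push {..<n} (star_edges n) X0 \<and>
          expected_consensus_time Push {..<n} (star_edges n) X0
            \<le> ennreal (10 * (real n ^ 2 * ln (real n)))"
          unfolding n expected_consensus_time_star_Push[OF m] using bounds by (simp only: ennreal_leI simp_thms)
      qed
    qed
  qed simp_all
  show "\<exists>b>0. \<forall>\<^sub>F n in sequentially. even n \<longrightarrow>
        (\<forall>X0. card {v \<in> {..<n}. X0 v = Red} = n div 2 \<and> card {v \<in> {..<n}. X0 v = Blue} = n div 2 \<longrightarrow>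
          expected_consensus_time Pull {..<n} (star_edges n) X0 \<le> ennreal (b * real n ^ 2))"
    by (rule exI[of _ 2], rule conjI[OF zero_less_numeral],
        rule eventually_mono[OF eventually_gt_at_top[of "0::nat"]])
      (blast intro: expected_consensus_time_star_Pull_le)
  show "\<exists>a>0. \<forall>\<^sub>F n in sequentially. even n \<longrightarrow>
        ennreal (a * 2 powr (real n / 5))
          \<le> expected_consensus_time Push {..<n} (double_star_edges n) (double_star_colouring n)"
    by (rule exI[of _ "1 / 256"], rule conjI, simp,
        rule eventually_mono[OF eventually_even_div_2[OF eventually_ge_at_top[of 21]]])
      (metis expected_consensus_time_double_star_Push_ge)
  show "\<exists>b>0. \<forall>\<^sub>F n in sequentially. even n \<longrightarrow>
        expected_consensus_time Pull {..<n} (double_star_edges n) (double_star_colouring n)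
          \<le> ennreal (b * real n ^ 4)"
    by (rule exI[of _ 1], rule conjI[OF zero_less_one],
        rule eventually_mono[OF eventually_even_div_2[OF eventually_gt_at_top[of 0]]])
      (metis expected_consensus_time_double_star_Pull_le mult_1)
qed

end
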